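(* Let $d\ge2$ and let $\{S_m\}_{m\ge0}$ be a random walk on $\mathbb{Z}^d$ started at $0$ with i.i.d. increments $X_1,X_2,\dots$ such that the group generated by the support of $X_1$ is all of $\mathbb{Z}^d$. Let $L_n$ be the number of inner boundary points of the range $\{S_m\}_{m=0}^n$, and let $$q=P\Big(\{S_m\}_{m=0}^{\infty}\cup\{S'_m\}_{m=0}^{\infty}\not\supset\mathcal{N}(0)\ \text{ and }\ 0\notin\{S_m\}_{m=1}^{\infty}\Big),$$ where $\{S'_m\}_{m\ge0}$ is a dual walk of $\{S_m\}_{m\ge0}$ independent of it. Then the limit $$\psi(x):=\lim_{n\to\infty}\frac{-1}{n}\log P(L_n\ge nx)$$ exists (in $[0,\infty]$) for all $x\in\mathbb{R}$, and $\psi$ has the following properties: (i) $\psi(x)=0$ for $x\le q$; (ii) $0<\psi(x)<\infty$ for $q<x\le1$; (iii) $\psi(x)=\infty$ for $x>1$; (iv) $\psi$ is continuous on $[0,1]$; (v) $\psi$ is convex on $[0,1]$; (vi) $\psi$ is strictly increasing on $[q,1]$.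
   Context: Random walk: $X_1,X_2,\dots$ are i.i.d. $\mathbb{Z}^d$-valued random variables, $S_0=0$ and $S_k=\sum_{i=1}^k X_i$; $P$ denotes the underlying probability law. For $a\in\mathbb{Z}^d$, $\mathcal{N}(a)=\{z\in\mathbb{Z}^d:\mathrm{dist}(a,z)=1\}$ is the set of the $2d$ nearest neighbors of $a$ in the lattice $\mathbb{Z}^d$ ($\mathrm{dist}$ is Euclidean distance). The inner boundary of the range $\{S_m\}_{m=0}^n$ is the set of points $H_n=\{S_i:0\le i\le n,\ \{S_m\}_{m=0}^n\not\supset\mathcal{N}(S_i)\}$, and $L_n=\sharp H_n$ is its cardinality (number of distinct points). The independent dual walk $\{S'_m\}_{m\ge0}$ is a process independent of $\{S_m\}_{m\ge0}$ with the same law as $\{-S_m\}_{m\ge0}$. Notation such as $\{S_m\}_{m=0}^{\infty}$ inside set relations denotes the set of sites visited. Convention: $-\log 0=+\infty$. *)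

theory Defs
  imports "HOL-Probability.Probability" "HOL-Computational_Algebra.Group_Closure"
begin

text \<open>The lattice \<open>\<int>\<^sup>d\<close> is the type \<^typ>\<open>int ^ 'd\<close> with \<open>d = CARD('d)\<close>.\<close>

text \<open>The library has no metric on \<^typ>\<open>int\<close>, so lattice points are
  embedded into \<^typ>\<open>real ^ 'd\<close> to measure Euclidean distance.\<close>

definition lattice_dist :: "int ^ 'd \<Rightarrow> int ^ 'd \<Rightarrow> real" where
  "lattice_dist a b =
     dist (\<chi> i. real_of_int (a $ i)) (\<chi> i. real_of_int (b $ i))"

definition nbrs :: "int ^ 'd \<Rightarrow> (int ^ 'd) set" where
  "nbrs a = {z. lattice_dist a z = 1}"

definition walk :: "(nat \<Rightarrow> 'a \<Rightarrow> int ^ 'd) \<Rightarrow> nat \<Rightarrow> 'a \<Rightarrow> int ^ 'd" where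
  "walk X k \<omega> = (\<Sum>i=1..k. X i \<omega>)"

text \<open>The increments are \<open>X 1, X 2, \<dots>\<close>; the value \<open>X 0\<close> is not used.\<close>

definition iid_increments :: "'a measure \<Rightarrow> (nat \<Rightarrow> 'a \<Rightarrow> int ^ 'd) \<Rightarrow> bool" where
  "iid_increments M X \<longleftrightarrow>
     prob_space.indep_vars M (\<lambda>_. count_space UNIV) X {1..} \<and>
     (\<forall>i\<ge>1. distr M (count_space UNIV) (X i) = distr M (count_space UNIV) (X 1))"

definition point_support :: "'a measure \<Rightarrow> ('a \<Rightarrow> int ^ 'd) \<Rightarrow> (int ^ 'd) set" where
  "point_support M Y = {z. measure M {\<omega> \<in> space M. Y \<omega> = z} > 0}"

definition inner_boundary :: "(nat \<Rightarrow> int ^ 'd) \<Rightarrow> nat \<Rightarrow> (int ^ 'd) set" where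
  "inner_boundary s n = {s i | i. i \<le> n \<and> \<not> nbrs (s i) \<subseteq> s ` {0..n}}"

definition boundary_count :: "(nat \<Rightarrow> 'a \<Rightarrow> int ^ 'd) \<Rightarrow> nat \<Rightarrow> 'a \<Rightarrow> nat" where
  "boundary_count S n \<omega> = card (inner_boundary (\<lambda>m. S m \<omega>) n)"

abbreviation path_space :: "(nat \<Rightarrow> int ^ 'd) measure" where
  "path_space \<equiv> Pi\<^sub>M UNIV (\<lambda>_. count_space UNIV)"

text \<open>Independence and equality in law are those of the whole processes, viewed as
  random elements of the path space.\<close>

definition independent_dual_walk ::
    "'a measure \<Rightarrow> (nat \<Rightarrow> 'a \<Rightarrow> int ^ 'd) \<Rightarrow> (nat \<Rightarrow> 'a \<Rightarrow> int ^ 'd) \<Rightarrow> bool" where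
  "independent_dual_walk M S S' \<longleftrightarrow>
     prob_space.indep_var M path_space (\<lambda>\<omega> m. S m \<omega>) path_space (\<lambda>\<omega> m. S' m \<omega>) \<and>
     distr M path_space (\<lambda>\<omega> m. S' m \<omega>) = distr M path_space (\<lambda>\<omega> m. - S m \<omega>)"

text \<open>\<open>-log p\<close> with the convention \<open>-log 0 = +\<infinity>\<close>; on reals, \<^term>\<open>ln 0 = (0::real)\<close>.\<close>

definition neg_log :: "real \<Rightarrow> ereal" where
  "neg_log p = (if p = 0 then \<infinity> else ereal (- ln p))"

end

theory Submission
  imports Defs "HOL-Real_Asymp.Real_Asymp"
begin

text \<open>The boundary count is exactly subadditive under concatenation of paths, and approximately
  superadditive: two paths can be joined by about \<open>k\<close> steps so that the second one is shifted by any
  of \<open>k\<^sup>2\<close> different vectors, hence in some shift the two ranges nearly meet in at most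
  \<open>O(n m / k\<^sup>2)\<close> pairs of points. With \<open>k\<close> of order \<open>(n + m)\<^sup>\<alpha>\<close>, \<open>\<alpha> = 3/4\<close>, all errors are sublinear, and a
  Hammersley-type argument gives a convex rate for every level \<open>x < 1\<close>.

  Subadditivity bounds exponential moments. At levels near \<open>1\<close> it compares the tail with the
  probability that every visited point is new and stays on the boundary, which identifies the rate at
  \<open>1\<close> with its left limit. For \<open>x > q\<close> it gives a Chernoff bound on blocks, because the expected
  count in \<open>n\<close> steps is \<open>n q + o(n)\<close>: seen from its position at the last visit of a point, the walk
  is a walk into the future together with an independent dual walk into the past. Expectation
  at least \<open>(n + 1) q\<close> gives rate \<open>0\<close> up to \<open>q\<close>; strict monotonicity then follows from convexity.\<close>

section \<open>Approximately supermultiplicative tail probabilities\<close>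

text \<open>The second path may fill in neighbours of the first, so it has to be moved away at small
  cost. A connection along one direction would give only \<open>k\<close> shifts, and a loss of
  order \<open>n m / k\<close> is not sublinear for any sublinear \<open>k\<close>. Two linearly
  independent steps of positive probability, which exist because the support generates a lattice of
  dimension at least two, give \<open>k\<^sup>2\<close> shifts, and \<open>n m / k\<^sup>2\<close>
  is at most of order \<open>k\<close> once \<open>k\<close> has order at least
  \<open>(n + m)\<close> to the power 2/3. The exponent 3/4 is one choice between 2/3 and 1. The
  connection has \<open>2 * k\<close> steps, so its probability cost is exponential in
  \<open>k\<close>, of the same order as the loss in level.

  These errors are compensated by aiming at a slightly higher level. At level 1 there is no room for
  this, and convexity alone would still allow a jump at an endpoint; hence the separate treatment of
  level 1 by subadditivity.\<close>

text \<open>Write each power as \<open>t * t powr (-1/4)\<close>. Comparability bounds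
  \<open>n\<close> and \<open>m\<close> by two thirds of the sum \<open>s\<close>, so
  \<open>t powr (-1/4)\<close> is at least \<open>(3/2) powr (1/4)\<close> times
  \<open>s powr (-1/4)\<close>, and \<open>(11/10)^4 = 1.4641\<close> is below
  \<open>3/2\<close>.\<close>

lemma powr_three_quarters_gap:
  fixes n m :: real
  assumes "0 < n" "0 < m" "n \<le> 2 * m" "m \<le> 2 * n"
  shows "(11/10) * (n + m) powr (3/4) \<le> n powr (3/4) + m powr (3/4)"
proof -
  define s where "s = n + m"
  have s: "s > 0" using assms by (simp add: s_def)
  have ineq: "t * (s powr (-1/4)) * (11/10) \<le> t powr (3/4)" if "0 < t" "3 * t \<le> 2 * s" for t
  proof -
    have q: "(11/10::real) \<le> (2/3) powr (-1/4)"
    proof -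
      have "(11/10::real) = ((11/10)^4) powr (1/4)"
        by (simp add: powr_powr flip: powr_numeral)
      also have "\<dots> \<le> (3/2) powr (1/4)"
        by (intro powr_mono2) (auto simp: power4_eq_xxxx)
      also have "\<dots> = (2/3) powr (-1/4)"
        by (simp add: powr_minus_divide powr_divide)
      finally show ?thesis .
    qed
    have "s powr (-1/4) * (11/10) \<le> s powr (-1/4) * (2/3) powr (-1/4)"
      using q by (intro mult_left_mono) auto
    also have "\<dots> = (s * (2/3)) powr (-1/4)"
      using s by (subst powr_mult) auto
    also have "\<dots> \<le> t powr (-1/4)"
      using that by (intro powr_mono2') auto
    finally have "t * (s powr (-1/4) * (11/10)) \<le> t * t powr (-1/4)"
      using that by (intro mult_left_mono) auto
    also have "t * t powr (-1/4) = t powr (3/4)"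
      using that powr_add[of t 1 "-1/4"] by simp
    finally show ?thesis by (simp add: mult.assoc)
  qed
  have "s powr (3/4) = s * s powr (-1/4)"
    using s powr_add[of s 1 "-1/4"] by simp
  also have "(11/10) * \<dots> = n * (s powr (-1/4)) * (11/10) + m * (s powr (-1/4)) * (11/10)"
    by (simp add: s_def algebra_simps)
  also have "\<dots> \<le> n powr (3/4) + m powr (3/4)"
    using assms by (intro add_mono ineq) (auto simp: s_def)
  finally show ?thesis by (simp add: s_def)
qed

lemma powr_three_quarters_sublinear:
  assumes "\<delta> > 0"
  shows "eventually (\<lambda>n. D * real n powr (3/4) \<le> \<delta> * real n) sequentially"
proof -
  have "((\<lambda>n::nat. D * real n powr (3/4) / real n) \<longlongrightarrow> 0) sequentially"
    by real_asymp
  then have "eventually (\<lambda>n::nat. D * real n powr (3/4) / real n < \<delta>) sequentially"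
    using assms by (rule order_tendstoD)
  then show ?thesis using eventually_gt_at_top[of 0]
    by eventually_elim (simp add: field_simps)
qed

text \<open>\<open>p n y\<close> stands for the probability that a walk of \<open>n\<close> steps
  has at least \<open>y\<close> boundary points. \<open>merge\<close> is the joining of two paths,
  \<open>extend\<close> says that each further step destroys at most \<open>b\<close> boundary
  points, and \<open>full\<close> comes from walking along a straight line.\<close>

locale near_supermultiplicative =
  fixes p :: "nat \<Rightarrow> real \<Rightarrow> real" and C b c :: real
  assumes C_nonneg: "0 \<le> C" and b_nonneg: "0 \<le> b" and c_pos: "0 < c"
    and p_nonneg: "0 \<le> p n y"
    and p_le_1: "p n y \<le> 1"
    and p_antimono: "y \<le> z \<Longrightarrow> p n z \<le> p n y"
    and merge: "1 \<le> n \<Longrightarrow> 1 \<le> m \<Longrightarrow> p n y * p m z * exp (- (C * real (n + m) powr (3/4)))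
                \<le> p (n + m) (y + z - C * real (n + m) powr (3/4))"
    and extend: "p n y \<le> p (n + r) (y - b * real r)"
    and full: "c ^ n \<le> p n (real n)"
begin

text \<open>Since \<open>n\<^sup>\<alpha> + m\<^sup>\<alpha> - (n + m)\<^sup>\<alpha>\<close> is of order \<open>(n + m)\<^sup>\<alpha>\<close> when \<open>n\<close> and \<open>m\<close> are comparable
  and \<open>\<alpha> < 1\<close>, a shift of the level by a multiple of \<open>n\<^sup>\<alpha>\<close> absorbs the error in \<open>merge\<close>.\<close>

definition corr :: "nat \<Rightarrow> real" where "corr n = 10 * C * real n powr (3/4)"

definition G :: "nat \<Rightarrow> real \<Rightarrow> real" where "G n y = exp (- corr n) * p n (y + corr n)"

lemma corr_nonneg: "0 \<le> corr n"
  using C_nonneg by (simp add: corr_def)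

lemma G_nonneg: "0 \<le> G n y"
  by (simp add: G_def p_nonneg)

lemma G_le_p: "G n y \<le> p n y"
proof -
  have "G n y \<le> p n (y + corr n)"
    unfolding G_def using corr_nonneg p_nonneg by (intro mult_left_le_one_le) auto
  also have "\<dots> \<le> p n y" using corr_nonneg by (intro p_antimono) auto
  finally show ?thesis .
qed

lemma G_le_1: "G n y \<le> 1"
  using G_le_p p_le_1 order_trans by blast

lemma G_antimono: "y \<le> z \<Longrightarrow> G n z \<le> G n y"
  by (auto simp: G_def intro!: p_antimono)

lemma G_supermult:
  assumes "1 \<le> n" "1 \<le> m" "n \<le> 2 * m" "m \<le> 2 * n"
  shows "G n y * G m z \<le> G (n + m) (y + z)"
proof -
  define \<phi> where "\<phi> = C * real (n + m) powr (3/4)"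
  \<comment> \<open>The surplus of one tenth in the gap, multiplied by the 10 in
    \<open>corr\<close>, pays for exactly one error term \<open>\<phi>\<close>.\<close>
  have "C * ((11/10) * (real n + real m) powr (3/4)) \<le> C * (real n powr (3/4) + real m powr (3/4))"
    using assms C_nonneg by (intro mult_left_mono powr_three_quarters_gap) auto
  then have gap: "corr (n + m) + \<phi> \<le> corr n + corr m"
    by (simp add: corr_def \<phi>_def algebra_simps)
  have "G n y * G m z = exp (- (corr n + corr m - \<phi>)) *
      (p n (y + corr n) * p m (z + corr m) * exp (- \<phi>))"
    by (simp add: G_def mult_ac flip: exp_add)
  also have "\<dots> \<le> exp (- (corr n + corr m - \<phi>)) * p (n + m) ((y + corr n) + (z + corr m) - \<phi>)"
    using assms merge[of n m "y + corr n" "z + corr m"] by (intro mult_left_mono) (auto simp: \<phi>_def)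
  also have "\<dots> \<le> exp (- corr (n + m)) * p (n + m) (y + z + corr (n + m))"
    using gap by (intro mult_mono p_antimono p_nonneg) auto
  finally show ?thesis by (simp add: G_def)
qed

text \<open>Induction by halving instead of adding one block at a time: the halves differ by at most
  one block, which keeps their lengths within the factor 2 that \<open>G_supermult\<close>
  requires.\<close>

lemma G_multi:
  assumes "1 \<le> n" "1 \<le> j"
  shows "(\<Prod>i<j. G n (y i)) \<le> G (j * n) (\<Sum>i<j. y i)"
  using assms(2)
proof (induction j arbitrary: y rule: less_induct)
  case (less j)
  show ?case
  proof (cases "j = 1")
    case True
    then show ?thesis by simp
  next
    case False
    define k where "k = j div 2"
    define l where "l = j - k"
    have kl: "j = k + l" "1 \<le> k" "1 \<le> l" "k < j" "l < j" "k \<le> 2 * l" "l \<le> 2 * k"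
      using False less.prems by (auto simp: k_def l_def)
    have split_prod: "(\<Prod>i<k + l. f i) = (\<Prod>i<k. f i) * (\<Prod>i<l. f (k + i))" for f :: "nat \<Rightarrow> real"
      by (induction l) (auto simp: mult_ac)
    have split_sum: "(\<Sum>i<k + l. f i) = (\<Sum>i<k. f i) + (\<Sum>i<l. f (k + i))" for f :: "nat \<Rightarrow> real"
      by (induction l) auto
    have "(\<Prod>i<j. G n (y i)) = (\<Prod>i<k. G n (y i)) * (\<Prod>i<l. G n (y (k + i)))"
      unfolding kl(1) by (rule split_prod)
    also have "\<dots> \<le> G (k * n) (\<Sum>i<k. y i) * G (l * n) (\<Sum>i<l. y (k + i))"
      using kl by (intro mult_mono less.IH prod_nonneg G_nonneg ballI)
    also have "\<dots> \<le> G (k * n + l * n) ((\<Sum>i<k. y i) + (\<Sum>i<l. y (k + i)))"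
    proof (rule G_supermult)
      have "n * k \<le> n * (2 * l)" "n * l \<le> n * (2 * k)" using kl by (intro mult_le_mono2; simp)+
      then show "k * n \<le> 2 * (l * n)" "l * n \<le> 2 * (k * n)" by (simp_all add: mult_ac)
    qed (use kl assms in auto)
    also have "\<dots> = G (j * n) (\<Sum>i<j. y i)"
      unfolding kl(1) by (simp add: split_sum algebra_simps)
    finally show ?thesis .
  qed
qed

section \<open>Convexity and continuity of the rate below level 1\<close>

text \<open>As in Fekete's lemma, the limit is the infimum of the normalised values. Lengths with
  \<open>G = 0\<close> have to be left out, since \<open>ln 0 = 0\<close> would contribute a
  spurious rate 0.\<close>

definition rate_set :: "real \<Rightarrow> real set" where
  "rate_set x = {- ln (G n (real n * x)) / real n | n. 1 \<le> n \<and> 0 < G n (real n * x)}"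

definition rate :: "real \<Rightarrow> real" where "rate x = Inf (rate_set x)"

lemma p_pos: "x \<le> 1 \<Longrightarrow> 0 < p n (real n * x)"
proof -
  assume "x \<le> 1"
  then have "real n * x \<le> real n" using mult_left_mono[of x 1 "real n"] by simp
  then have "p n (real n) \<le> p n (real n * x)" by (rule p_antimono)
  moreover have "0 < c ^ n" using c_pos by simp
  ultimately show ?thesis using full[of n] by linarith
qed

lemma rate_set_nonneg: "u \<in> rate_set x \<Longrightarrow> 0 \<le> u"
  using G_le_1 by (auto simp: rate_set_def divide_le_0_iff ln_le_zero_iff)

lemma bdd_rate_set: "bdd_below (rate_set x)"
  using rate_set_nonneg by (rule bdd_belowI)

text \<open>The correction is sublinear, so for a level below 1 and large \<open>n\<close> the
  corrected level is still at most \<open>n\<close>, where \<open>full\<close> gives positive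
  probability. At level 1 no such room is left.\<close>

lemma rate_set_nonempty:
  assumes "x < 1" shows "rate_set x \<noteq> {}"
proof -
  have "eventually (\<lambda>n. 10 * C * real n powr (3/4) \<le> (1 - x) * real n) sequentially"
    using assms by (intro powr_three_quarters_sublinear) simp
  then have "eventually (\<lambda>n. 1 \<le> n \<and> corr n \<le> (1 - x) * real n) sequentially"
    using eventually_ge_at_top[of 1] by eventually_elim (simp add: corr_def)
  then obtain n where n: "1 \<le> n" "corr n \<le> (1 - x) * real n"
    unfolding eventually_at_top_linorder by blast
  have "0 < p n (real n * 1)" by (rule p_pos) simp
  also have "\<dots> \<le> p n (real n * x + corr n)"
    using n by (intro p_antimono) (simp add: algebra_simps)
  finally have "0 < G n (real n * x)" by (simp add: G_def)
  then show ?thesis using n unfolding rate_set_def by blast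
qed

lemma rate_nonneg: "x < 1 \<Longrightarrow> 0 \<le> rate x"
  unfolding rate_def by (rule cInf_greatest[OF rate_set_nonempty rate_set_nonneg])

lemma rate_le:
  assumes "1 \<le> n" "0 < G n (real n * x)"
  shows "rate x \<le> - ln (G n (real n * x)) / real n"
  unfolding rate_def using assms by (intro cInf_lower bdd_rate_set) (auto simp: rate_set_def)

lemma rate_mono:
  assumes "x \<le> y" "y < 1" shows "rate x \<le> rate y"
  unfolding rate_def[of y]
proof (rule cInf_greatest)
  fix u assume "u \<in> rate_set y"
  then obtain n where n: "1 \<le> n" "0 < G n (real n * y)" "u = - ln (G n (real n * y)) / real n"
    by (auto simp: rate_set_def)
  have le: "G n (real n * y) \<le> G n (real n * x)"
    using assms by (intro G_antimono mult_left_mono) auto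
  have "rate x \<le> - ln (G n (real n * x)) / real n"
    using n le by (intro rate_le) auto
  also have "\<dots> \<le> u"
    using n le by (auto intro!: divide_right_mono)
  finally show "rate x \<le> u" .
qed (use assms rate_set_nonempty in auto)

text \<open>For members \<open>u\<close>, \<open>v\<close> of the two rate sets, pass to the common
  block length \<open>n1 * n2\<close> and concatenate \<open>j\<close> blocks, \<open>i\<close> of
  them at level \<open>x\<close> and the others at level \<open>y\<close>. The infima over
  \<open>u\<close> and \<open>v\<close> are taken at the end.\<close>

lemma rate_convex_rational:
  assumes "x < 1" "y < 1" "i \<le> j" "1 \<le> j"
  shows "rate (real i / real j * x + (1 - real i / real j) * y)
    \<le> real i / real j * rate x + (1 - real i / real j) * rate y"
proof -
  define t where "t = real i / real j"
  have t: "0 \<le> t" "t \<le> 1" using assms by (auto simp: t_def)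
  have key: "rate (t * x + (1 - t) * y) \<le> t * u + (1 - t) * v"
    if uv: "u \<in> rate_set x" "v \<in> rate_set y" for u v
  proof -
    obtain n1 n2 where n1: "1 \<le> n1" "0 < G n1 (real n1 * x)" "u = - ln (G n1 (real n1 * x)) / real n1"
      and n2: "1 \<le> n2" "0 < G n2 (real n2 * y)" "v = - ln (G n2 (real n2 * y)) / real n2"
      using uv by (auto simp: rate_set_def)
    define n where "n = n1 * n2"
    have n: "1 \<le> n" using n1 n2 by (simp add: n_def)
    have Gx: "exp (- u * real n) \<le> G n (real n * x)"
    proof -
      have "exp (- u * real n) = exp (real n2 * ln (G n1 (real n1 * x)))"
        using n1 by (simp add: n_def)
      also have "\<dots> = (\<Prod>i<n2. G n1 (real n1 * x))"
        using n1 by (simp add: exp_of_nat_mult)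
      also have "\<dots> \<le> G (n2 * n1) (\<Sum>i<n2. real n1 * x)"
        using n1 n2 by (intro G_multi)
      finally show ?thesis by (simp add: n_def mult_ac)
    qed
    have Gy: "exp (- v * real n) \<le> G n (real n * y)"
    proof -
      have "exp (- v * real n) = exp (real n1 * ln (G n2 (real n2 * y)))"
        using n2 by (simp add: n_def)
      also have "\<dots> = (\<Prod>i<n1. G n2 (real n2 * y))"
        using n2 by (simp add: exp_of_nat_mult)
      also have "\<dots> \<le> G (n1 * n2) (\<Sum>i<n1. real n2 * y)"
        using n1 n2 by (intro G_multi)
      finally show ?thesis by (simp add: n_def mult_ac)
    qed
    define z where "z l = (if l < i then real n * x else real n * y)" for l
    have ij: "{..<j} \<inter> {l. l < i} = {..<i}" "{..<j} \<inter> - {l. l < i} = {i..<j}"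
      using assms by auto
    have "exp (- (real i * u + real (j - i) * v) * real n)
        = exp (- u * real n) ^ i * exp (- v * real n) ^ (j - i)"
      by (simp add: algebra_simps flip: exp_of_nat_mult exp_add)
    also have "\<dots> \<le> G n (real n * x) ^ i * G n (real n * y) ^ (j - i)"
      by (intro mult_mono power_mono Gx Gy) (auto simp: G_nonneg)
    also have "\<dots> = (\<Prod>l<j. G n (z l))"
      unfolding z_def if_distrib[of "G n"] by (subst prod.If_cases) (auto simp: ij)
    also have "\<dots> \<le> G (j * n) (\<Sum>l<j. z l)"
      using n assms by (intro G_multi)
    also have "(\<Sum>l<j. z l) = real (j * n) * (t * x + (1 - t) * y)"
    proof -
      have "(\<Sum>l<j. z l) = real i * (real n * x) + real (j - i) * (real n * y)"
        unfolding z_def by (subst sum.If_cases) (auto simp: ij)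
      also have "\<dots> = real (j * n) * (t * x + (1 - t) * y)"
        using assms by (simp add: t_def field_simps of_nat_diff)
      finally show ?thesis .
    qed
    finally have *: "exp (- (real i * u + real (j - i) * v) * real n)
        \<le> G (j * n) (real (j * n) * (t * x + (1 - t) * y))" .
    then have pos: "0 < G (j * n) (real (j * n) * (t * x + (1 - t) * y))"
      by (rule less_le_trans[OF exp_gt_zero])
    have jn: "1 \<le> j * n" using n assms by simp
    have "- (real i * u + real (j - i) * v) * real n
        \<le> ln (G (j * n) (real (j * n) * (t * x + (1 - t) * y)))"
      using * pos by (simp add: ln_ge_iff)
    then have "- ln (G (j * n) (real (j * n) * (t * x + (1 - t) * y))) / real (j * n)
        \<le> (real i * u + real (j - i) * v) * real n / real (j * n)"
      by (intro divide_right_mono; linarith?)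
    also have "\<dots> = t * u + (1 - t) * v"
      using n assms by (simp add: t_def field_simps of_nat_diff)
    finally show ?thesis
      using rate_le[OF jn pos] by linarith
  qed
  \<comment> \<open>The infimum is taken over \<open>v\<close> first and then over \<open>u\<close>.
    The weights 0 and 1 are treated apart because each infimum is reached by dividing by its
    weight.\<close>
  have "rate (t * x + (1 - t) * y) - t * u \<le> (1 - t) * rate y" if "u \<in> rate_set x" for u
  proof (cases "t = 1")
    case True
    then show ?thesis using key[OF that] rate_set_nonempty[OF assms(2)] by fastforce
  next
    case False
    then have t1: "0 < 1 - t" using t by simp
    have "(rate (t * x + (1 - t) * y) - t * u) / (1 - t) \<le> rate y"
      unfolding rate_def[of y]
    proof (rule cInf_greatest[OF rate_set_nonempty[OF assms(2)]])
      fix v assume "v \<in> rate_set y"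
      from key[OF that this] show "(rate (t * x + (1 - t) * y) - t * u) / (1 - t) \<le> v"
        using t1 by (simp add: pos_divide_le_eq mult.commute)
    qed
    then show ?thesis using t1 by (simp add: pos_divide_le_eq mult.commute)
  qed
  note 1 = this
  have "rate (t * x + (1 - t) * y) - (1 - t) * rate y \<le> t * rate x"
  proof (cases "t = 0")
    case True
    then show ?thesis using 1 rate_set_nonempty[OF assms(1)] by fastforce
  next
    case False
    then have t0: "0 < t" using t by simp
    have "(rate (t * x + (1 - t) * y) - (1 - t) * rate y) / t \<le> rate x"
      unfolding rate_def[of x]
    proof (rule cInf_greatest[OF rate_set_nonempty[OF assms(1)]])
      fix u assume "u \<in> rate_set x"
      from 1[OF this] show "(rate (t * x + (1 - t) * y) - (1 - t) * rate y) / t \<le> u"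
        using t0 by (simp add: pos_divide_le_eq mult.commute)
    qed
    then show ?thesis using t0 by (simp add: pos_divide_le_eq mult.commute)
  qed
  then show ?thesis unfolding t_def by simp
qed

text \<open>Real weights are approximated from below by \<open>floor (t * j) / j\<close>. With
  \<open>x \<le> y\<close>, rounding the weight of \<open>x\<close> down moves the point to the
  right, so monotonicity of \<open>rate\<close> suffices for the limit; continuity is itself derived
  from convexity and cannot be used here.\<close>

lemma convex_on_rate: "convex_on {..<1} rate"
proof (rule convex_onI)
  have *: "rate (t * x + (1 - t) * y) \<le> t * rate x + (1 - t) * rate y"
    if t: "0 < t" "t < 1" and xy: "x < 1" "y < 1" "x \<le> y" for t x y :: real
  proof -
    define r where "r j = real (nat \<lfloor>t * real j\<rfloor>) / real j" for j
    have lim: "r \<longlonglongrightarrow> t"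
      unfolding r_def using t by real_asymp
    have "rate (t * x + (1 - t) * y) \<le> r j * rate x + (1 - r j) * rate y" if j: "1 \<le> j" for j
    proof -
      have r: "r j \<le> t"
        using t j by (simp add: r_def field_simps of_nat_nat)
      have le: "nat \<lfloor>t * real j\<rfloor> \<le> j"
      proof -
        have "t * real j \<le> 1 * real j" using t by (intro mult_right_mono) auto
        then show ?thesis by (simp add: nat_le_iff floor_le_iff)
      qed
      have r0: "0 \<le> r j" "r j \<le> 1" using r t by (auto simp: r_def)
      have "0 \<le> (t - r j) * (y - x)"
        using r xy by (intro mult_nonneg_nonneg) auto
      then have "t * x + (1 - t) * y \<le> r j * x + (1 - r j) * y"
        by (simp add: algebra_simps)
      moreover have "r j * x + (1 - r j) * y \<le> y"
        using mult_left_mono[OF xy(3) r0(1)] by (simp add: algebra_simps)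
      ultimately have "rate (t * x + (1 - t) * y) \<le> rate (r j * x + (1 - r j) * y)"
        using xy by (intro rate_mono) auto
      also have "\<dots> \<le> r j * rate x + (1 - r j) * rate y"
        unfolding r_def using xy j le by (intro rate_convex_rational)
      finally show ?thesis .
    qed
    moreover have "(\<lambda>j. r j * rate x + (1 - r j) * rate y) \<longlonglongrightarrow> t * rate x + (1 - t) * rate y"
      by (intro tendsto_intros lim)
    ultimately show ?thesis by (intro LIMSEQ_le_const) auto
  qed
  fix t x y :: real
  assume A: "0 < t" "t < 1" "x \<in> {..<1}" "y \<in> {..<1}"
  show "rate ((1 - t) *\<^sub>R x + t *\<^sub>R y) \<le> (1 - t) * rate x + t * rate y"
  proof (cases "x \<le> y")
    case True
    then show ?thesis using *[of "1 - t" x y] A by simp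
  next
    case False
    then show ?thesis using *[of t y x] A by (simp add: add.commute)
  qed
qed (rule convex_real_interval)

lemma isCont_rate: "x < 1 \<Longrightarrow> isCont rate x"
  using convex_on_continuous[OF open_lessThan convex_on_rate]
  by (simp add: continuous_on_eq_continuous_at)

section \<open>Existence of the limit below level 1\<close>

text \<open>A path of \<open>k\<close> steps is cut into \<open>j\<close> blocks of length
  \<open>n\<close> and a remainder shorter than \<open>n\<close>. Only the remainder is handled by
  \<open>extend\<close>, and its bounded loss disappears in \<open>\<delta> * k\<close>.\<close>

lemma rate_upper:
  assumes n: "1 \<le> n" "0 < G n (real n * x)" and "\<delta> > 0"
  shows "eventually (\<lambda>k. - ln (p k (real k * (x - \<delta>))) / real k \<le> - ln (G n (real n * x)) / real n)
    sequentially"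
proof -
  define g where "g = G n (real n * x)"
  define N where "N = max n (nat \<lceil>real n * (\<bar>x\<bar> + b) / \<delta>\<rceil>)"
  have g: "0 < g" "g \<le> 1" using n G_le_1 by (auto simp: g_def)
  have "- ln (p k (real k * (x - \<delta>))) / real k \<le> - ln g / real n" if k: "N \<le> k" for k
  proof -
    define j r where "j = k div n" and "r = k mod n"
    have kn: "n \<le> k" "real n * (\<bar>x\<bar> + b) / \<delta> \<le> real k" using k by (auto simp: N_def)
    have kd: "k = j * n + r" "r < n" "1 \<le> j"
      using n kn by (auto simp: j_def r_def Suc_le_eq div_greater_zero_iff)
    have "g ^ j = (\<Prod>i<j. G n (real n * x))" by (simp add: g_def)
    also have "\<dots> \<le> G (j * n) (\<Sum>i<j. real n * x)"
      using n kd by (intro G_multi)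
    also have "\<dots> \<le> p (j * n) (real j * (real n * x))"
      using G_le_p by simp
    also have "\<dots> \<le> p (j * n + r) (real j * (real n * x) - b * real r)"
      by (rule extend)
    also have "\<dots> \<le> p k (real k * (x - \<delta>))"
      unfolding kd(1)[symmetric]
    proof (rule p_antimono)
      have "real r * (x + b) \<le> real r * (\<bar>x\<bar> + b)"
        by (intro mult_left_mono) auto
      also have "\<dots> \<le> real n * (\<bar>x\<bar> + b)"
        using kd b_nonneg by (intro mult_right_mono) auto
      also have "\<dots> \<le> \<delta> * real k" using kn assms by (simp add: field_simps)
      finally have "real r * (x + b) \<le> \<delta> * real k" .
      moreover have "real k = real j * real n + real r" using kd by simp
      ultimately show "real k * (x - \<delta>) \<le> real j * (real n * x) - b * real r"
        by (simp add: algebra_simps)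
    qed
    finally have gj: "g ^ j \<le> p k (real k * (x - \<delta>))" .
    then have pos: "0 < p k (real k * (x - \<delta>))" using g by (meson less_le_trans zero_less_power)
    have "real j * ln g \<le> ln (p k (real k * (x - \<delta>)))"
      using gj g pos by (simp add: ln_realpow[symmetric])
    moreover have "real j * real n \<le> real k" using kd by simp
    moreover have "0 \<le> - ln g" using g by simp
    ultimately have "- ln (p k (real k * (x - \<delta>))) * real n \<le> - ln g * real k"
    proof -
      have "- ln (p k (real k * (x - \<delta>))) * real n \<le> (real j * (- ln g)) * real n"
        using \<open>real j * ln g \<le> _\<close> by (intro mult_right_mono) auto
      also have "\<dots> = - ln g * (real j * real n)" by simp
      also have "\<dots> \<le> - ln g * real k" using \<open>0 \<le> - ln g\<close> kd by (intro mult_left_mono) auto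
      finally show ?thesis .
    qed
    then show ?thesis using n kn by (simp add: divide_simps)
  qed
  then show ?thesis unfolding g_def eventually_at_top_linorder by blast
qed

text \<open>The level \<open>x - \<delta>\<close> raised by the sublinear correction stays below
  \<open>x\<close>, so the probability at level \<open>x\<close> is at most
  \<open>exp (corr n) * G n (n * (x - \<delta>))\<close>, to which the infimum defining
  \<open>rate (x - \<delta>)\<close> applies.\<close>

lemma rate_lower:
  assumes "x < 1" "\<delta> > 0"
  shows "eventually (\<lambda>n. rate (x - \<delta>) \<le> - ln (p n (real n * x)) / real n + corr n / real n) sequentially"
proof -
  have "eventually (\<lambda>n. 10 * C * real n powr (3/4) \<le> \<delta> * real n) sequentially"
    using assms by (intro powr_three_quarters_sublinear) simp
  then show ?thesis using eventually_ge_at_top[of 1]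
  proof eventually_elim
    case (elim n)
    have pos: "0 < p n (real n * x)" using assms by (intro p_pos) simp
    have le: "p n (real n * x) \<le> p n (real n * (x - \<delta>) + corr n)"
      using elim by (intro p_antimono) (simp add: corr_def algebra_simps)
    then have pos': "0 < p n (real n * (x - \<delta>) + corr n)" using pos by linarith
    have "rate (x - \<delta>) \<le> - ln (G n (real n * (x - \<delta>))) / real n"
      using elim pos' by (intro rate_le) (auto simp: G_def)
    also have "\<dots> = (- ln (p n (real n * (x - \<delta>) + corr n)) + corr n) / real n"
      using pos' by (simp add: G_def ln_mult)
    also have "\<dots> \<le> (- ln (p n (real n * x)) + corr n) / real n"
      using le pos pos' by (intro divide_right_mono) auto
    finally show ?case by (simp only: add_divide_distrib)
  qed
qed

text \<open>The two one-sided bounds hold only after moving the level by an arbitrarily small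
  amount; continuity of \<open>rate\<close> at \<open>x\<close> closes the gap.\<close>

lemma rate_limit:
  assumes x: "x < 1"
  shows "(\<lambda>n. - ln (p n (real n * x)) / real n) \<longlonglongrightarrow> rate x"
proof (rule order_tendstoI)
  have corr0: "(\<lambda>n. corr n / real n) \<longlonglongrightarrow> 0"
    unfolding corr_def by real_asymp
  have left: "(rate \<longlongrightarrow> rate x) (at_left x)" and right: "(rate \<longlongrightarrow> rate x) (at_right x)"
    using isCont_rate[OF x] unfolding isCont_def by (simp_all add: filterlim_at_split)
  {
    fix a assume "a < rate x"
    then have "eventually (\<lambda>y. a < rate y) (at_left x)"
      by (rule order_tendstoD(1)[OF left])
    then obtain y where y: "y < x" "a < rate y"
      unfolding eventually_at_left_field using dense by blast
    have "eventually (\<lambda>n. rate y \<le> - ln (p n (real n * x)) / real n + corr n / real n) sequentially"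
      using rate_lower[OF x, of "x - y"] y by simp
    moreover have "eventually (\<lambda>n. corr n / real n < rate y - a) sequentially"
      using corr0 y by (intro order_tendstoD) auto
    ultimately show "eventually (\<lambda>n. a < - ln (p n (real n * x)) / real n) sequentially"
      by eventually_elim linarith
  next
    fix a assume "rate x < a"
    then have "eventually (\<lambda>y. rate y < a \<and> y < 1) (at_right x)"
      by (intro eventually_conj order_tendstoD(2)[OF right] order_tendstoD(2)[OF tendsto_ident_at x])
    then obtain y where y: "x < y" "rate y < a" "y < 1"
      unfolding eventually_at_right_field using dense by blast
    then obtain n where n: "1 \<le> n" "0 < G n (real n * y)" "- ln (G n (real n * y)) / real n < a"
      using rate_set_nonempty[of y] cInf_lessD[of "rate_set y" a] by (auto simp: rate_def rate_set_def)
    with rate_upper[of n y "y - x"] y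
    show "eventually (\<lambda>n. - ln (p n (real n * x)) / real n < a) sequentially"
      by (auto elim: eventually_mono)
  }
qed

end

section \<open>The rate at full level\<close>

text \<open>\<open>f k\<close> stands for the probability that each of \<open>k\<close> steps adds a
  point that remains on the boundary. It is submultiplicative, in the direction opposite to
  \<open>merge\<close>, and \<open>p_le_f\<close> is a Chernoff bound that controls levels slightly
  below 1 by the full event on blocks.\<close>

locale near_supermultiplicative_top = near_supermultiplicative +
  fixes f :: "nat \<Rightarrow> real"
  assumes f_pos: "0 < f k"
    and f_le_p: "f n \<le> p n (real n)"
    and f_mult: "f (m * k) \<le> f k ^ m"
    and p_le_f: "1 \<le> k \<Longrightarrow> 0 \<le> \<epsilon> \<Longrightarrow>
      p (j * k) (1 + (1 - \<epsilon>) * real (j * k)) \<le> (2 * f k powr (1 - \<epsilon> * real k)) ^ j"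
begin

definition top_rate :: real where "top_rate = Sup (rate ` {..<1})"

definition ext_rate :: "real \<Rightarrow> real" where "ext_rate x = (if x < 1 then rate x else top_rate)"

lemma rate_le_ln: "x < 1 \<Longrightarrow> rate x \<le> - ln c"
proof (rule LIMSEQ_le_const2[OF rate_limit])
  assume x: "x < 1"
  have "- ln (p n (real n * x)) / real n \<le> - ln c" if n: "1 \<le> n" for n
  proof -
    have "real n * x \<le> real n" using x mult_left_mono[of x 1 "real n"] by simp
    then have "c ^ n \<le> p n (real n * x)" using full p_antimono order_trans by blast
    then have "ln (c ^ n) \<le> ln (p n (real n * x))"
      using c_pos p_pos[of x n] x by (subst ln_le_cancel_iff) auto
    then show ?thesis using n c_pos by (simp add: ln_realpow field_simps)
  qed
  then show "\<exists>N. \<forall>n\<ge>N. - ln (p n (real n * x)) / real n \<le> - ln c" by blast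
qed

lemma rate_le_top: "x < 1 \<Longrightarrow> rate x \<le> top_rate"
  unfolding top_rate_def using rate_le_ln by (intro cSup_upper bdd_aboveI2) auto

lemma top_rate_nonneg: "0 \<le> top_rate"
  using rate_le_top[of 0] rate_nonneg[of 0] by simp

text \<open>\<open>p_le_f\<close> is applied with \<open>2 * \<epsilon>\<close>: for large
  \<open>j\<close> the extra \<open>\<epsilon> * j * k\<close> absorbs the additive 1 in its level.
  The limit is taken along multiples of \<open>k\<close>, where blocks fit without
  remainder.\<close>

lemma rate_ge_f:
  assumes k: "1 \<le> k" and \<epsilon>: "0 < \<epsilon>"
  shows "- ln 2 / real k + (1 - 2 * \<epsilon> * real k) * (- ln (f k) / real k) \<le> rate (1 - \<epsilon>)"
proof -
  define a where "a n = - ln (p n (real n * (1 - \<epsilon>))) / real n" for n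
  have "a \<longlonglongrightarrow> rate (1 - \<epsilon>)" unfolding a_def using \<epsilon> by (intro rate_limit) simp
  then have lim: "(\<lambda>j. a (j * k)) \<longlonglongrightarrow> rate (1 - \<epsilon>)"
    using k LIMSEQ_subseq_LIMSEQ[of a _ "\<lambda>j. j * k"] by (simp add: strict_mono_def o_def)
  obtain J where J: "1 / \<epsilon> \<le> real J" using real_arch_simple by blast
  have "- ln 2 / real k + (1 - 2 * \<epsilon> * real k) * (- ln (f k) / real k) \<le> a (j * k)" if j: "max 1 J \<le> j" for j
  proof -
    have "1 \<le> \<epsilon> * real J" using J \<epsilon> by (simp add: field_simps)
    also have "\<dots> \<le> \<epsilon> * real (j * k)"
    proof -
      have "J \<le> j * k" using j k mult_le_mono[of J j 1 k] by simp
      then show ?thesis using \<epsilon> by (intro mult_left_mono) (auto simp del: of_nat_mult)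
    qed
    finally have "1 + (1 - 2 * \<epsilon>) * real (j * k) \<le> real (j * k) * (1 - \<epsilon>)"
      by (simp add: algebra_simps)
    then have "p (j * k) (real (j * k) * (1 - \<epsilon>)) \<le> p (j * k) (1 + (1 - 2 * \<epsilon>) * real (j * k))"
      by (rule p_antimono)
    also have "\<dots> \<le> (2 * f k powr (1 - (2 * \<epsilon>) * real k)) ^ j"
      using \<epsilon> k by (intro p_le_f) auto
    finally have "ln (p (j * k) (real (j * k) * (1 - \<epsilon>))) \<le> ln ((2 * f k powr (1 - 2 * \<epsilon> * real k)) ^ j)"
      using p_pos[of "1 - \<epsilon>" "j * k"] \<epsilon> f_pos[of k]
      by (subst ln_le_cancel_iff) (auto intro!: mult_pos_pos zero_less_power)
    also have "\<dots> = real j * (ln 2 + (1 - 2 * \<epsilon> * real k) * ln (f k))"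
      using f_pos[of k] by (simp add: ln_realpow ln_mult ln_powr algebra_simps)
    finally have "real j * (- (ln 2 + (1 - 2 * \<epsilon> * real k) * ln (f k))) \<le>
        - ln (p (j * k) (real (j * k) * (1 - \<epsilon>)))" by linarith
    then have "real j * (- (ln 2 + (1 - 2 * \<epsilon> * real k) * ln (f k))) / real (j * k) \<le> a (j * k)"
      unfolding a_def by (intro divide_right_mono) auto
    moreover have "real j * (- (ln 2 + (1 - 2 * \<epsilon> * real k) * ln (f k))) / real (j * k)
        = - ln 2 / real k + (1 - 2 * \<epsilon> * real k) * (- ln (f k) / real k)"
      using j k by (simp add: divide_simps)
    ultimately show ?thesis by linarith
  qed
  then show ?thesis by (intro LIMSEQ_le_const[OF lim]) blast
qed

text \<open>First \<open>\<epsilon>\<close> tends to 0 with \<open>k\<close> fixed; this order is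
  forced by the factor \<open>\<epsilon> * k\<close>. The remaining error \<open>ln 2 / k\<close> is
  removed by passing from \<open>k\<close> to \<open>m * k\<close>, since by submultiplicativity the
  normalised rate of \<open>f\<close> does not decrease along multiples.\<close>

lemma f_rate_le_top:
  assumes k: "1 \<le> k"
  shows "- ln (f k) / real k \<le> top_rate"
proof -
  have *: "- ln 2 / real k + (- ln (f k) / real k) \<le> top_rate" if k: "1 \<le> k" for k
  proof (rule tendsto_upperbound)
    have "((\<lambda>\<epsilon>. - ln 2 / real k + (1 - 2 * \<epsilon> * real k) * (- ln (f k) / real k))
        \<longlongrightarrow> - ln 2 / real k + (1 - 2 * 0 * real k) * (- ln (f k) / real k)) (at_right 0)"
      by (intro tendsto_intros)
    then show "((\<lambda>\<epsilon>. - ln 2 / real k + (1 - 2 * \<epsilon> * real k) * (- ln (f k) / real k))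
        \<longlongrightarrow> - ln 2 / real k + (- ln (f k) / real k)) (at_right 0)"
      by simp
    show "eventually (\<lambda>\<epsilon>. - ln 2 / real k + (1 - 2 * \<epsilon> * real k) * (- ln (f k) / real k) \<le> top_rate) (at_right 0)"
      unfolding eventually_at_right_field
    proof (intro exI[of _ 1] conjI allI impI)
      fix \<epsilon> :: real assume "0 < \<epsilon>" "\<epsilon> < 1"
      then show "- ln 2 / real k + (1 - 2 * \<epsilon> * real k) * (- ln (f k) / real k) \<le> top_rate"
        using rate_ge_f[OF k, of \<epsilon>] rate_le_top[of "1 - \<epsilon>"] by linarith
    qed simp
  qed simp
  have "- ln 2 / (real m * real k) + (- ln (f k) / real k) \<le> top_rate" if m: "1 \<le> m" for m
  proof -
    have "ln (f (m * k)) \<le> ln (f k ^ m)"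
      using f_mult f_pos by (subst ln_le_cancel_iff) auto
    then have "- ln (f k) / real k \<le> - ln (f (m * k)) / real (m * k)"
      using m k f_pos[of k] by (simp add: ln_realpow field_simps)
    with *[of "m * k"] m k show ?thesis by simp
  qed
  moreover have "(\<lambda>m. - ln 2 / (real m * real k) + (- ln (f k) / real k)) \<longlonglongrightarrow> 0 + (- ln (f k) / real k)"
    using k by (intro tendsto_add tendsto_const) real_asymp
  ultimately show ?thesis
    by (intro LIMSEQ_le_const2[of _ _ top_rate]) auto
qed

section \<open>Extension of the rate to level 1\<close>

lemma rate_tendsto_top: "(rate \<longlongrightarrow> top_rate) (at_left 1)"
proof (rule order_tendstoI)
  fix a assume "a < top_rate"
  then obtain x where x: "x < 1" "a < rate x"
    unfolding top_rate_def using less_cSupE[of a "rate ` {..<1}"] by auto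
  then show "eventually (\<lambda>y. a < rate y) (at_left 1)"
    unfolding eventually_at_left_field
    by (intro exI[of _ x]) (meson less_imp_le less_le_trans rate_mono)
next
  fix a assume "top_rate < a"
  then show "eventually (\<lambda>y. rate y < a) (at_left 1)"
    unfolding eventually_at_left_field
    by (intro exI[of _ 0]) (meson le_less_trans rate_le_top zero_less_one)
qed

text \<open>At level 1 the upper bound comes from the event measured by \<open>f\<close>, whose rate
  never exceeds \<open>top_rate\<close>; the lower bound compares with levels below 1, whose rates
  have supremum \<open>top_rate\<close>.\<close>

lemma ext_rate_limit:
  assumes "x \<le> 1"
  shows "(\<lambda>n. - ln (p n (real n * x)) / real n) \<longlonglongrightarrow> ext_rate x"
proof (cases "x < 1")
  case True
  then show ?thesis using rate_limit by (simp add: ext_rate_def)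
next
  case False
  then have x: "x = 1" using assms by simp
  have upper: "- ln (p n (real n)) / real n \<le> top_rate" if n: "1 \<le> n" for n
  proof -
    have "ln (f n) \<le> ln (p n (real n))"
      using f_le_p[of n] f_pos[of n] p_pos[of 1 n] by (subst ln_le_cancel_iff) auto
    then have "- ln (p n (real n)) / real n \<le> - ln (f n) / real n" by (intro divide_right_mono) auto
    then show ?thesis using f_rate_le_top[OF n] by linarith
  qed
  have "(\<lambda>n. - ln (p n (real n)) / real n) \<longlonglongrightarrow> top_rate"
  proof (rule order_tendstoI)
    fix a assume "a < top_rate"
    then obtain y where y: "y < 1" "a < rate y"
      unfolding top_rate_def using less_cSupE[of a "rate ` {..<1}"] by auto
    have "eventually (\<lambda>n. a < - ln (p n (real n * y)) / real n) sequentially"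
      using rate_limit[OF y(1)] y(2) by (rule order_tendstoD)
    then show "eventually (\<lambda>n. a < - ln (p n (real n)) / real n) sequentially"
    proof eventually_elim
      case (elim n)
      have "real n * y \<le> real n" using y mult_left_mono[of y 1 "real n"] by simp
      then have "p n (real n) \<le> p n (real n * y)" by (rule p_antimono)
      then have "ln (p n (real n)) \<le> ln (p n (real n * y))"
        using p_pos[of 1 n] p_pos[of y n] y by (subst ln_le_cancel_iff) auto
      then have "- ln (p n (real n * y)) / real n \<le> - ln (p n (real n)) / real n"
        by (intro divide_right_mono) auto
      with elim show ?case by linarith
    qed
  next
    fix a assume "top_rate < a"
    then show "eventually (\<lambda>n. - ln (p n (real n)) / real n < a) sequentially"
      by (intro eventually_mono[OF eventually_ge_at_top[of 1]]) (use upper in \<open>force intro: le_less_trans\<close>)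
  qed
  then show ?thesis by (simp add: x ext_rate_def)
qed

lemma ext_rate_mono: "x \<le> y \<Longrightarrow> y \<le> 1 \<Longrightarrow> ext_rate x \<le> ext_rate y"
  using rate_mono rate_le_top by (auto simp: ext_rate_def)

lemma ext_rate_nonneg: "0 \<le> ext_rate x"
  using rate_nonneg top_rate_nonneg by (auto simp: ext_rate_def)

lemma continuous_on_ext_rate: "continuous_on {..1} ext_rate"
  unfolding continuous_on_def
proof
  fix x :: real assume x: "x \<in> {..1}"
  show "(ext_rate \<longlongrightarrow> ext_rate x) (at x within {..1})"
  proof (cases "x < 1")
    case True
    have ev: "eventually (\<lambda>y. rate y = ext_rate y) (at x)"
      using order_tendstoD(2)[OF tendsto_ident_at True, of UNIV] by eventually_elim (simp add: ext_rate_def)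
    have "(rate \<longlongrightarrow> rate x) (at x)" using isCont_rate[OF True] by (simp add: isCont_def)
    then have "(ext_rate \<longlongrightarrow> rate x) (at x)"
      using ev by (rule Lim_transform_eventually)
    then show ?thesis using True by (auto simp: ext_rate_def intro: tendsto_within_subset)
  next
    case False
    then have [simp]: "x = 1" using x by simp
    have "eventually (\<lambda>y. rate y = ext_rate y) (at_left (1::real))"
      by (auto simp: eventually_at_filter ext_rate_def)
    with rate_tendsto_top have "(ext_rate \<longlongrightarrow> top_rate) (at_left 1)"
      by (rule Lim_transform_eventually)
    then show ?thesis by (simp add: ext_rate_def flip: at_within_Iic_at_left[of "1::real"])
  qed
qed

text \<open>Moving all points left by the same amount \<open>1 / (n + 1)\<close> commutes with
  convex combinations and makes the convexity of \<open>rate\<close> applicable; monotonicity and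
  continuity of \<open>ext_rate\<close> give the limit.\<close>

lemma convex_on_ext_rate: "convex_on {..1} ext_rate"
proof (rule convex_onI)
  fix t x y :: real
  assume A: "0 < t" "t < 1" "x \<in> {..1}" "y \<in> {..1}"
  define sh where "sh z n = z - 1 / real (Suc n)" for z :: real and n
  have sh: "sh z \<longlonglongrightarrow> z" "\<And>n. z \<le> 1 \<Longrightarrow> sh z n < 1" "\<And>n. sh z n \<le> z" for z
  proof -
    have "(\<lambda>n. z - 1 / real (Suc n)) \<longlonglongrightarrow> z - 0" by (intro tendsto_intros) real_asymp
    then show "sh z \<longlonglongrightarrow> z" by (simp add: sh_def[abs_def])
    show "sh z n < 1" if "z \<le> 1" for n 
    proof -
      have "0 < 1 / real (Suc n)" by simp
      then show ?thesis using that unfolding sh_def by linarith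
    qed
    show "sh z n \<le> z" for n by (simp add: sh_def)
  qed
  define w where "w = (1 - t) * x + t * y"
  have w: "w \<le> 1" unfolding w_def using A by (intro convex_bound_le) auto
  have sh_w: "sh w n = (1 - t) * sh x n + t * sh y n" for n
    by (simp add: sh_def w_def algebra_simps flip: add_divide_distrib)
  have "ext_rate (sh w n) \<le> (1 - t) * ext_rate x + t * ext_rate y" for n
  proof -
    have "ext_rate (sh w n) = rate ((1 - t) *\<^sub>R sh x n + t *\<^sub>R sh y n)"
      using sh(2)[OF w] by (simp add: ext_rate_def flip: sh_w)
    also have "\<dots> \<le> (1 - t) * rate (sh x n) + t * rate (sh y n)"
      using A sh(2) by (intro convex_onD[OF convex_on_rate]) auto
    also have "\<dots> = (1 - t) * ext_rate (sh x n) + t * ext_rate (sh y n)"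
      using A sh(2) by (simp add: ext_rate_def)
    also have "\<dots> \<le> (1 - t) * ext_rate x + t * ext_rate y"
      using A sh(3) by (intro add_mono mult_left_mono ext_rate_mono) auto
    finally show ?thesis .
  qed
  moreover have "(\<lambda>n. ext_rate (sh w n)) \<longlonglongrightarrow> ext_rate w"
    using sh(1)[of w] sh(2)[OF w, THEN less_imp_le] w
    by (intro continuous_on_tendsto_compose[OF continuous_on_ext_rate]) auto
  ultimately have "ext_rate w \<le> (1 - t) * ext_rate x + t * ext_rate y"
    by (intro LIMSEQ_le_const2) auto
  then show "ext_rate ((1 - t) *\<^sub>R x + t *\<^sub>R y) \<le> (1 - t) * ext_rate x + t * ext_rate y"
    by (simp add: w_def)
qed (rule convex_real_interval)

end

section \<open>Inner boundaries of finite lattice sets\<close>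

lemma lattice_dist_eq:
  fixes a b :: "int ^ 'd"
  shows "lattice_dist a b = lattice_dist 0 (b - a)"
proof -
  have "(\<chi> i. real_of_int (a $ i)) - (\<chi> i. real_of_int (b $ i)) =
      (\<chi> i. real_of_int ((0 :: int ^ 'd) $ i)) - (\<chi> i. real_of_int ((b - a) $ i))"
    by (simp add: vec_eq_iff)
  then show ?thesis
    by (simp only: lattice_dist_def dist_norm)
qed

lemma lattice_dist_commute: "lattice_dist a b = lattice_dist b a"
  by (simp add: lattice_dist_def dist_commute)

lemma nbrs_iff: "z \<in> nbrs a \<longleftrightarrow> z - a \<in> nbrs 0"
  using lattice_dist_eq[of a z] by (simp add: nbrs_def)

lemma nbrs_sym: "z \<in> nbrs a \<longleftrightarrow> a \<in> nbrs z"
  by (simp add: nbrs_def lattice_dist_commute)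

lemma nbrs_uminus: "- e \<in> nbrs 0 \<longleftrightarrow> e \<in> nbrs 0"
  using nbrs_iff[of 0 e] nbrs_sym[of 0 e] by simp

lemma nbrs_translate: "nbrs (v + a) = (+) v ` nbrs a"
proof (intro equalityI subsetI)
  fix z assume "z \<in> nbrs (v + a)"
  then have "z - v \<in> nbrs a"
    using nbrs_iff[of z "v + a"] nbrs_iff[of "z - v" a] by (simp add: algebra_simps)
  then show "z \<in> (+) v ` nbrs a" by (intro image_eqI[of _ _ "z - v"]) auto
next
  fix z assume "z \<in> (+) v ` nbrs a"
  then obtain y where "z = v + y" "y \<in> nbrs a" by blast
  then show "z \<in> nbrs (v + a)"
    using nbrs_iff[of z "v + a"] nbrs_iff[of y a] by (simp add: algebra_simps)
qed

lemma finite_nbrs: "finite (nbrs (a :: int ^ 'd))"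
proof -
  have "e $ i \<in> {-1..1}" if e: "e \<in> nbrs 0" for e :: "int ^ 'd" and i
  proof -
    have "\<bar>(\<chi> i. real_of_int (e $ i)) $ i\<bar> \<le> norm (\<chi> i. real_of_int (e $ i))"
      by (rule component_le_norm_cart)
    also have "\<dots> = 1"
      using e by (simp add: nbrs_def lattice_dist_def dist_norm flip: zero_vec_def)
    finally show ?thesis by auto
  qed
  then have "nbrs (0 :: int ^ 'd) \<subseteq> {e. \<forall>i. e $ i \<in> {-1..1}}" by blast
  moreover have "finite {e :: int ^ 'd. \<forall>i. e $ i \<in> {-1..1}}"
  proof -
    have "{e :: int ^ 'd. \<forall>i. e $ i \<in> {-1..1}} \<subseteq> vec_lambda ` (UNIV \<rightarrow>\<^sub>E {-1..1})"
      by (auto simp: image_iff intro!: bexI[of _ "vec_nth _"])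
    moreover have "finite ((UNIV :: 'd set) \<rightarrow>\<^sub>E {-1..1 :: int})" by (intro finite_PiE) auto
    ultimately show ?thesis using finite_subset by blast
  qed
  ultimately have "finite (nbrs (0 :: int ^ 'd))" by (rule finite_subset)
  then show ?thesis using nbrs_translate[of a 0] by simp
qed

lemma axis_in_nbrs: "axis i 1 \<in> nbrs 0"
proof -
  have "(\<chi> j. real_of_int (axis i 1 $ j)) = axis i 1"
    by (simp add: vec_eq_iff axis_def)
  then show ?thesis
    by (simp add: nbrs_def lattice_dist_def dist_norm flip: zero_vec_def)
qed

section \<open>Boundary of a union of finite sets\<close>

definition bdry :: "(int ^ 'd) set \<Rightarrow> (int ^ 'd) set" where
  "bdry A = {a \<in> A. \<not> nbrs a \<subseteq> A}"

definition nbhd0 :: "(int ^ 'd) set" where "nbhd0 = insert 0 (nbrs 0)"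

definition nbhd :: "(int ^ 'd) set \<Rightarrow> (int ^ 'd) set" where
  "nbhd A = (\<Union>e\<in>nbhd0. (\<lambda>a. a + e) ` A)"

lemma finite_nbhd0: "finite nbhd0"
  by (simp add: nbhd0_def finite_nbrs)

lemma nbhd0_uminus: "- e \<in> nbhd0 \<longleftrightarrow> e \<in> nbhd0"
  by (auto simp: nbhd0_def nbrs_uminus)

lemma bdry_subset: "bdry A \<subseteq> A"
  by (auto simp: bdry_def)

lemma finite_bdry: "finite A \<Longrightarrow> finite (bdry A)"
  using bdry_subset finite_subset by blast

lemma bdry_translate: "bdry ((+) v ` A) = (+) v ` bdry A"
proof -
  have "v + a \<in> bdry ((+) v ` A) \<longleftrightarrow> a \<in> bdry A" for a
    by (auto simp: bdry_def nbrs_translate inj_image_subset_iff)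
  moreover have "bdry ((+) v ` A) \<subseteq> (+) v ` A" by (rule bdry_subset)
  ultimately show ?thesis using bdry_subset[of A] by blast
qed

lemma card_bdry_translate: "card (bdry ((+) v ` A)) = card (bdry A)"
  by (simp add: bdry_translate card_image)

lemma bdry_Un_subset: "bdry (A \<union> B) \<subseteq> bdry A \<union> bdry B"
  by (auto simp: bdry_def)

lemma subset_nbhd: "A \<subseteq> nbhd A"
  by (force simp: nbhd_def nbhd0_def)

lemma finite_nbhd: "finite A \<Longrightarrow> finite (nbhd A)"
  by (simp add: nbhd_def finite_nbhd0)

text \<open>The missing neighbour of a boundary point of \<open>A\<close> can be filled by
  \<open>B\<close> only if that point is adjacent to \<open>B\<close>.\<close>

lemma bdry_diff_nbhd: "bdry A - nbhd B \<subseteq> bdry (A \<union> B)"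
proof
  fix a assume a: "a \<in> bdry A - nbhd B"
  then obtain z where z: "z \<in> nbrs a" "z \<notin> A" by (auto simp: bdry_def)
  have "z \<notin> B"
  proof
    assume "z \<in> B"
    moreover have "a - z \<in> nbhd0" using z(1) nbrs_sym nbrs_iff by (auto simp: nbhd0_def)
    ultimately have "z + (a - z) \<in> nbhd B" unfolding nbhd_def by blast
    with a show False by simp
  qed
  with a z show "a \<in> bdry (A \<union> B)" by (auto simp: bdry_def)
qed

lemma card_inter_nbhd: "finite A \<Longrightarrow> card (A \<inter> nbhd B) \<le> (\<Sum>e\<in>nbhd0. card (A \<inter> (\<lambda>b. b + e) ` B))"
  unfolding nbhd_def Int_UN_distrib by (intro card_UN_le finite_nbhd0)

lemma card_nbhd:
  fixes A :: "(int ^ 'd) set"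
  shows "card (nbhd A) \<le> card (nbhd0 :: (int ^ 'd) set) * card A"
proof -
  have "card (nbhd A) \<le> (\<Sum>e\<in>nbhd0. card ((\<lambda>b. b + e) ` A))"
    unfolding nbhd_def by (intro card_UN_le finite_nbhd0)
  also have "\<dots> = card (nbhd0 :: (int ^ 'd) set) * card A"
    by (simp add: card_image)
  finally show ?thesis .
qed

text \<open>Exchanging the two sets turns the offset \<open>e\<close> into \<open>- e\<close>, and
  \<open>nbhd0\<close> is symmetric. Both sets thus have the same bound on their losses.\<close>

lemma sum_card_inter_commute:
  fixes A B :: "(int ^ 'd) set"
  assumes "finite A" "finite B"
  shows "(\<Sum>e\<in>nbhd0. card (B \<inter> (\<lambda>a. a + e) ` A)) = (\<Sum>e\<in>nbhd0. card (A \<inter> (\<lambda>b. b + e) ` B))"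
proof (rule sum.reindex_bij_witness[of _ uminus uminus])
  fix e :: "int ^ 'd"
  have "bij_betw (\<lambda>b. b - e) (B \<inter> (\<lambda>a. a + e) ` A) (A \<inter> (\<lambda>b. b + - e) ` B)"
    by (rule bij_betw_byWitness[of _ "\<lambda>a. a + e"]) (force+)
  then show "card (A \<inter> (\<lambda>b. b + - e) ` B) = card (B \<inter> (\<lambda>a. a + e) ` A)"
    by (simp add: bij_betw_same_card)
qed (auto simp: nbhd0_uminus)

text \<open>Boundary points of either set away from the other one survive. The two surviving
  families are disjoint because a neighbourhood contains its set; what is lost lies in a
  near-intersection, once for each set, hence the factor 2.\<close>

lemma card_bdry_Un_ge:
  assumes "finite A" "finite B"
  shows "card (bdry A) + card (bdry B) \<le>
    card (bdry (A \<union> B)) + 2 * (\<Sum>e\<in>nbhd0. card (A \<inter> (\<lambda>b. b + e) ` B))"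
proof -
  have 1: "card (bdry A) \<le> card (bdry A - nbhd B) + card (A \<inter> nbhd B)" if "finite A" for A B :: "(int ^ 'd) set"
  proof -
    have "bdry A \<subseteq> (bdry A - nbhd B) \<union> (A \<inter> nbhd B)" using bdry_subset by blast
    then have "card (bdry A) \<le> card ((bdry A - nbhd B) \<union> (A \<inter> nbhd B))"
      using that by (intro card_mono) (auto simp: finite_bdry)
    also have "\<dots> \<le> card (bdry A - nbhd B) + card (A \<inter> nbhd B)" by (rule card_Un_le)
    finally show ?thesis .
  qed
  have "card (bdry A - nbhd B) + card (bdry B - nbhd A) = card ((bdry A - nbhd B) \<union> (bdry B - nbhd A))"
    using assms subset_nbhd[of B] bdry_subset[of B]
    by (intro card_Un_disjoint[symmetric]) (auto simp: finite_bdry)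
  also have "\<dots> \<le> card (bdry (A \<union> B))"
    using assms bdry_diff_nbhd[of A B] bdry_diff_nbhd[of B A]
    by (intro card_mono) (auto simp: finite_bdry Un_commute)
  finally show ?thesis
    using 1[OF assms(1), of B] 1[OF assms(2), of A] card_inter_nbhd[OF assms(1), of B]
      card_inter_nbhd[OF assms(2), of A] sum_card_inter_commute[OF assms] by linarith
qed

lemma card_bdry_Un_ge_left:
  fixes A B :: "(int ^ 'd) set"
  assumes "finite A" "finite B"
  shows "card (bdry A) \<le> card (bdry (A \<union> B)) + card (nbhd0 :: (int ^ 'd) set) * card B"
proof -
  have "bdry A \<subseteq> bdry (A \<union> B) \<union> nbhd B" using bdry_diff_nbhd by blast
  then have "card (bdry A) \<le> card (bdry (A \<union> B) \<union> nbhd B)"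
    using assms by (intro card_mono) (auto simp: finite_bdry finite_nbhd)
  also have "\<dots> \<le> card (bdry (A \<union> B)) + card (nbhd B)" by (rule card_Un_le)
  finally show ?thesis using card_nbhd[of B] by linarith
qed

text \<open>Each pair of a point of \<open>A\<close> and a point of \<open>B\<close> meets for at most one shift, so among
  many shifts of \<open>B\<close> some produce only few near-intersections with \<open>A\<close>.\<close>

lemma exists_good_shift:
  fixes A B :: "(int ^ 'd) set" and v :: "'i \<Rightarrow> int ^ 'd"
  assumes "finite A" "finite B" "finite I" "I \<noteq> {}" "inj_on v I"
  shows "\<exists>i\<in>I. card I * (\<Sum>e\<in>nbhd0. card (A \<inter> (\<lambda>b. b + e) ` (+) (v i) ` B))
    \<le> card (nbhd0 :: (int ^ 'd) set) * (card A * card B)"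
proof -
  let ?f = "\<lambda>i. \<Sum>e\<in>nbhd0. card (A \<inter> (\<lambda>b. b + e) ` (+) (v i) ` B)"
  have 1: "(\<Sum>i\<in>I. card (A \<inter> (\<lambda>b. b + e) ` (+) (v i) ` B)) \<le> card A * card B" for e
  proof -
    let ?S = "SIGMA i:I. A \<inter> (\<lambda>b. b + e) ` (+) (v i) ` B"
    have "(\<Sum>i\<in>I. card (A \<inter> (\<lambda>b. b + e) ` (+) (v i) ` B)) = card ?S"
      using assms by simp
    also have "\<dots> \<le> card (A \<times> B)"
    proof (rule card_inj_on_le[of "\<lambda>(i, a). (a, a - e - v i)"])
      show "inj_on (\<lambda>(i, a). (a, a - e - v i)) ?S"
        using assms(5) by (auto simp: inj_on_def)
    qed (use assms in auto)
    finally show ?thesis by (simp add: card_cartesian_product)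
  qed
  have "(\<Sum>i\<in>I. ?f i) = (\<Sum>e\<in>nbhd0. \<Sum>i\<in>I. card (A \<inter> (\<lambda>b. b + e) ` (+) (v i) ` B))"
    by (rule sum.swap)
  also have "\<dots> \<le> (\<Sum>e\<in>(nbhd0 :: (int ^ 'd) set). card A * card B)"
    by (intro sum_mono 1)
  finally have 2: "(\<Sum>i\<in>I. ?f i) \<le> card (nbhd0 :: (int ^ 'd) set) * (card A * card B)" by simp
  obtain i where i: "i \<in> I" "\<And>j. j \<in> I \<Longrightarrow> ?f i \<le> ?f j"
  proof -
    have "arg_min_on ?f I \<in> I" using assms by (intro arg_min_if_finite)
    moreover have "?f (arg_min_on ?f I) \<le> ?f j" if "j \<in> I" for j
      using assms that by (intro arg_min_least)
    ultimately show ?thesis using that by blast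
  qed
  have "card I * ?f i \<le> (\<Sum>i\<in>I. ?f i)"
    using sum_bounded_below[of I "?f i" ?f] i by simp
  with 2 i show ?thesis by (meson order_trans)
qed

section \<open>Paths given by their increments\<close>

text \<open>A path is represented by its increments, so that joining paths is list append and the
  law of \<open>n\<close> steps is a product law on lists. The partial sums include the start 0 and
  the end point.\<close>

definition sites :: "(int ^ 'd) list \<Rightarrow> (int ^ 'd) set" where
  "sites xs = (\<lambda>i. sum_list (take i xs)) ` {..length xs}"

lemma sites_Nil [simp]: "sites [] = {0}"
  by (simp add: sites_def)

lemma sites_Cons: "sites (x # xs) = insert 0 ((+) x ` sites xs)"
  unfolding sites_def by (simp add: atMost_Suc_eq_insert_0 image_image)

lemma finite_sites: "finite (sites xs)"
  by (simp add: sites_def)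

lemma zero_in_sites: "0 \<in> sites xs"
  by (cases xs) (simp_all add: sites_Cons)

lemma sum_in_sites: "sum_list xs \<in> sites xs"
  unfolding sites_def by (rule image_eqI[of _ _ "length xs"]) auto

lemma sites_append: "sites (xs @ ys) = sites xs \<union> (+) (sum_list xs) ` sites ys"
proof (induction xs)
  case Nil
  then show ?case using zero_in_sites[of ys] by auto
next
  case (Cons x xs)
  then show ?case by (simp add: sites_Cons image_Un image_image add.assoc)
qed

lemma card_sites_diff_zero: "card (sites xs - {0}) \<le> length xs"
proof -
  have "sites xs - {0} \<subseteq> (\<lambda>i. sum_list (take i xs)) ` {1..length xs}"
  proof
    fix z assume z: "z \<in> sites xs - {0}"
    then obtain i where i: "i \<le> length xs" "z = sum_list (take i xs)" by (auto simp: sites_def)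
    then have "1 \<le> i" using z by (cases i) auto
    with i show "z \<in> (\<lambda>i. sum_list (take i xs)) ` {1..length xs}" by auto
  qed
  then have "card (sites xs - {0}) \<le> card ((\<lambda>i. sum_list (take i xs)) ` {1..length xs})"
    by (intro card_mono) auto
  also have "\<dots> \<le> length xs" using card_image_le[of "{1..length xs}"] by simp
  finally show ?thesis .
qed

lemma card_sites: "card (sites xs) \<le> length xs + 1"
  using card_sites_diff_zero[of xs] zero_in_sites[of xs] finite_sites[of xs] by simp

text \<open>Seen from its end point, a path visits the negatives of the partial sums of the reversed
  increments. This is where the dual walk comes from.\<close>

lemma sites_rev: "(+) (- sum_list us) ` sites us = uminus ` sites (rev us)"
proof (induction us rule: rev_induct)
  case (snoc u us)
  have "(+) (- sum_list (us @ [u])) ` sites (us @ [u])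
      = (+) (- u) ` (+) (- sum_list us) ` sites us \<union> {0}"
  proof -
    have "sites (us @ [u]) = insert (sum_list us + u) (sites us)"
      using sum_in_sites[of us] by (auto simp: sites_append sites_Cons)
    then show ?thesis by (auto simp: image_image algebra_simps)
  qed
  also have "\<dots> = uminus ` sites (rev (us @ [u]))"
    unfolding snoc by (auto simp: sites_Cons image_image algebra_simps)
  finally show ?case .
qed simp

definition nbdry :: "(int ^ 'd) list \<Rightarrow> nat" where "nbdry xs = card (bdry (sites xs))"

text \<open>Not counting the starting point makes the boundary count exactly subadditive under
  concatenation, and bounded by the number of steps.\<close>

definition nbdry0 :: "(int ^ 'd) list \<Rightarrow> nat" where "nbdry0 xs = card (bdry (sites xs) - {0})"

lemma nbdry_le: "nbdry xs \<le> length xs + 1"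
  unfolding nbdry_def using card_mono[OF finite_sites bdry_subset] card_sites le_trans by blast

lemma nbdry0_le: "nbdry0 xs \<le> length xs"
  unfolding nbdry0_def
  by (rule le_trans[OF card_mono card_sites_diff_zero]) (use finite_sites bdry_subset in auto)

lemma nbdry0_le_nbdry: "nbdry0 xs \<le> nbdry xs"
  unfolding nbdry0_def nbdry_def by (intro card_mono finite_bdry finite_sites) auto

lemma nbdry_le_nbdry0: "nbdry xs \<le> nbdry0 xs + 1"
  unfolding nbdry0_def nbdry_def using card_Suc_Diff1[of "bdry (sites xs)" 0]
  by (cases "0 \<in> bdry (sites xs)") (auto simp: finite_bdry finite_sites)

text \<open>The junction is the only point needing care. As the start of the second path it is left
  out of \<open>nbdry0 ys\<close>, but it is also the end point of the first path and is covered
  there.\<close>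

lemma nbdry0_append: "nbdry0 (xs @ ys) \<le> nbdry0 xs + nbdry0 ys"
proof -
  let ?s = "sum_list xs"
  have "bdry (sites (xs @ ys)) - {0} \<subseteq> (bdry (sites xs) - {0}) \<union> (+) ?s ` (bdry (sites ys) - {0})"
  proof
    fix z assume z: "z \<in> bdry (sites (xs @ ys)) - {0}"
    show "z \<in> (bdry (sites xs) - {0}) \<union> (+) ?s ` (bdry (sites ys) - {0})"
    proof (cases "z = ?s")
      case True
      then show ?thesis using z sum_in_sites[of xs] by (auto simp: bdry_def sites_append)
    next
      case False
      have "z \<in> bdry (sites xs) \<union> (+) ?s ` bdry (sites ys)"
        using z bdry_Un_subset[of "sites xs" "(+) ?s ` sites ys"] by (auto simp: sites_append bdry_translate)
      then show ?thesis using False z by auto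
    qed
  qed
  then have "nbdry0 (xs @ ys) \<le> card ((bdry (sites xs) - {0}) \<union> (+) ?s ` (bdry (sites ys) - {0}))"
    unfolding nbdry0_def by (intro card_mono) (auto simp: finite_bdry finite_sites)
  also have "\<dots> \<le> nbdry0 xs + card ((+) ?s ` (bdry (sites ys) - {0}))"
    unfolding nbdry0_def by (rule card_Un_le)
  also have "card ((+) ?s ` (bdry (sites ys) - {0})) = nbdry0 ys"
    by (simp add: card_image nbdry0_def)
  finally show ?thesis by simp
qed

lemma nbdry_append_le: "nbdry (xs @ ys) \<le> nbdry xs + length ys + 1"
  using nbdry_le_nbdry0[of "xs @ ys"] nbdry0_append[of xs ys] nbdry0_le[of ys] nbdry0_le_nbdry[of xs]
  by linarith

lemma nbdry_append_ge:
  fixes xs ys :: "(int ^ 'd) list"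
  shows "nbdry xs \<le> nbdry (xs @ ys) + 2 * card (nbhd0 :: (int ^ 'd) set) * length ys"
proof (cases "ys = []")
  case False
  have "nbdry xs \<le> nbdry (xs @ ys) + card (nbhd0 :: (int ^ 'd) set) * card ((+) (sum_list xs) ` sites ys)"
    unfolding nbdry_def sites_append by (intro card_bdry_Un_ge_left) (auto simp: finite_sites)
  \<comment> \<open>For nonempty \<open>ys\<close> the \<open>length ys + 1\<close> sites are at
    most \<open>2 * length ys\<close>, which explains the factor 2 in the statement.\<close>
  also have "card ((+) (sum_list xs) ` sites ys) \<le> 2 * length ys"
    using card_sites[of ys] False by (cases ys) (auto simp: card_image)
  finally show ?thesis by (simp add: mult_ac)
qed simp

section \<open>Joining two paths\<close>

text \<open>The shift of \<open>ys\<close> is controlled by \<open>i\<close> and \<open>j\<close>;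
  the final steps \<open>a\<close> bring the inserted steps to a total of \<open>2 * k\<close>, so
  that all choices yield paths of one common length.\<close>

definition connect ::
  "int ^ 'd \<Rightarrow> int ^ 'd \<Rightarrow> nat \<Rightarrow> nat \<Rightarrow> nat \<Rightarrow> (int ^ 'd) list \<Rightarrow> (int ^ 'd) list \<Rightarrow> (int ^ 'd) list" where
  "connect a b k i j xs ys = xs @ replicate i a @ replicate j b @ ys @ replicate (2 * k - i - j) a"

text \<open>Linear independence, expressed by a nonzero 2 by 2 minor.\<close>

definition independent_steps :: "int ^ 'd \<Rightarrow> int ^ 'd \<Rightarrow> bool" where
  "independent_steps a b \<longleftrightarrow> (\<exists>l m. a $ l * b $ m \<noteq> a $ m * b $ l)"

lemma sum_list_replicate_nth: "sum_list (replicate n (a :: int ^ 'd)) $ l = int n * a $ l"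
  by (induction n) (simp_all add: algebra_simps)

lemma inj_steps:
  assumes "independent_steps a b"
  shows "inj_on (\<lambda>(i, j). s + sum_list (replicate i a) + sum_list (replicate j b)) I"
proof (rule inj_onI, clarify)
  fix i j i' j'
  assume eq: "s + sum_list (replicate i a) + sum_list (replicate j b) =
    s + sum_list (replicate i' a) + sum_list (replicate j' b)"
  obtain l m where lm: "a $ l * b $ m \<noteq> a $ m * b $ l"
    using assms by (auto simp: independent_steps_def)
  have e: "(int i - int i') * a $ h + (int j - int j') * b $ h = 0" for h
    using arg_cong[OF eq, of "\<lambda>v. v $ h"] by (simp add: sum_list_replicate_nth algebra_simps)
  have "(int i - int i') * (a $ l * b $ m - a $ m * b $ l) =
      ((int i - int i') * a $ l + (int j - int j') * b $ l) * b $ m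
      - ((int i - int i') * a $ m + (int j - int j') * b $ m) * b $ l"
    by (simp add: algebra_simps)
  then have "(int i - int i') * (a $ l * b $ m - a $ m * b $ l) = 0" using e by simp
  then have i: "i = i'" using lm by simp
  have "(int j - int j') * (a $ l * b $ m - a $ m * b $ l) =
      ((int i - int i') * a $ m + (int j - int j') * b $ m) * a $ l
      - ((int i - int i') * a $ l + (int j - int j') * b $ l) * a $ m"
    by (simp add: algebra_simps)
  then have "(int j - int j') * (a $ l * b $ m - a $ m * b $ l) = 0" using e by simp
  then show "i = i' \<and> j = j'" using lm i by simp
qed

text \<open>The first error term is the loss for a shift under which the two ranges have few
  near-intersections. The remaining terms come from the inserted steps: they visit at most
  \<open>2 * k + 2\<close> points, and each can spoil only boundary points in its own
  neighbourhood.\<close>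

lemma nbdry_connect:
  fixes xs ys :: "(int ^ 'd) list"
  assumes ab: "independent_steps a b" and k: "1 \<le> k"
  defines "N \<equiv> real (card (nbhd0 :: (int ^ 'd) set))"
  shows "\<exists>i<k. \<exists>j<k. real (nbdry xs) + real (nbdry ys) \<le> real (nbdry (connect a b k i j xs ys))
    + N * (2 * (real (length xs) + 1) * (real (length ys) + 1) / (real k)\<^sup>2 + 2 * real k + 2)"
proof -
  define v where "v = (\<lambda>(i, j). sum_list xs + sum_list (replicate i a) + sum_list (replicate j b))"
  define A B where "A = sites xs" and "B = sites ys"
  let ?I = "{..<k} \<times> {..<k}"
  define loss where "loss i = (\<Sum>e\<in>nbhd0. card (A \<inter> (\<lambda>b. b + e) ` (+) (v i) ` B))" for i
  have inj: "inj_on v ?I" unfolding v_def by (rule inj_steps[OF ab])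
  obtain i j where ij: "i < k" "j < k"
    and le: "card ?I * loss (i, j) \<le> card (nbhd0 :: (int ^ 'd) set) * (card A * card B)"
  proof -
    have "finite A" "finite B" "finite ?I" "?I \<noteq> {}"
      using k by (auto simp: A_def B_def finite_sites lessThan_empty_iff)
    from exists_good_shift[OF this inj] show ?thesis using that by (auto simp: loss_def)
  qed
  define M where "M = (+) (sum_list xs) ` sites (replicate i a @ replicate j b)
    \<union> (+) (v (i, j) + sum_list ys) ` sites (replicate (2 * k - i - j) a)"
  have path: "sites (connect a b k i j xs ys) = (A \<union> (+) (v (i, j)) ` B) \<union> M"
  proof -
    have "connect a b k i j xs ys = xs @ (replicate i a @ replicate j b) @ ys @ replicate (2 * k - i - j) a"
      by (simp add: connect_def)
    then show ?thesis
      by (simp add: M_def A_def B_def v_def sites_append image_Un image_image add.assoc Un_ac)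
  qed
  have finM: "finite M" by (simp add: M_def finite_sites)
  have "card M \<le> card ((+) (sum_list xs) ` sites (replicate i a @ replicate j b))
      + card ((+) (v (i, j) + sum_list ys) ` sites (replicate (2 * k - i - j) a))"
    unfolding M_def by (rule card_Un_le)
  also have "\<dots> \<le> (i + j + 1) + (2 * k - i - j + 1)"
    using card_sites[of "replicate i a @ replicate j b"] card_sites[of "replicate (2 * k - i - j) a"]
    by (simp add: card_image)
  also have "\<dots> = 2 * k + 2" using ij by simp
  finally have M: "real (card M) \<le> 2 * real k + 2" by linarith
  have 1: "nbdry xs + nbdry ys \<le> card (bdry (A \<union> (+) (v (i, j)) ` B)) + 2 * loss (i, j)"
    using card_bdry_Un_ge[of A "(+) (v (i, j)) ` B"]
    by (simp add: nbdry_def A_def B_def finite_sites card_bdry_translate loss_def)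
  have 2: "card (bdry (A \<union> (+) (v (i, j)) ` B)) \<le> nbdry (connect a b k i j xs ys)
      + card (nbhd0 :: (int ^ 'd) set) * card M"
    unfolding nbdry_def path by (intro card_bdry_Un_ge_left) (auto simp: A_def B_def finite_sites finM)
  have "real (card ?I * loss (i, j)) \<le> real (card (nbhd0 :: (int ^ 'd) set) * (card A * card B))"
    using le by (rule of_nat_mono)
  also have "\<dots> \<le> N * ((real (length xs) + 1) * (real (length ys) + 1))"
    unfolding of_nat_mult N_def A_def B_def using card_sites[of xs] card_sites[of ys]
    by (intro mult_left_mono mult_mono) auto
  finally have 3: "real (loss (i, j)) \<le> N * ((real (length xs) + 1) * (real (length ys) + 1)) / (real k)\<^sup>2"
    using k by (simp add: field_simps power2_eq_square)
  have "real (nbdry xs) + real (nbdry ys) \<le> real (nbdry (connect a b k i j xs ys)) + N * real (card M)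
      + 2 * real (loss (i, j))"
  proof -
    have "nbdry xs + nbdry ys \<le> nbdry (connect a b k i j xs ys)
        + card (nbhd0 :: (int ^ 'd) set) * card M + 2 * loss (i, j)"
      using 1 2 by linarith
    then have "real (nbdry xs + nbdry ys) \<le> real (nbdry (connect a b k i j xs ys)
        + card (nbhd0 :: (int ^ 'd) set) * card M + 2 * loss (i, j))"
      by (rule of_nat_mono)
    then show ?thesis by (simp add: N_def)
  qed
  also have "N * real (card M) \<le> N * (2 * real k + 2)"
    using M by (intro mult_left_mono) (auto simp: N_def)
  finally have "real (nbdry xs) + real (nbdry ys) \<le> real (nbdry (connect a b k i j xs ys))
      + (N * (2 * real k + 2) + 2 * (N * ((real (length xs) + 1) * (real (length ys) + 1)) / (real k)\<^sup>2))"
    using 3 by linarith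
  also have "N * (2 * real k + 2) + 2 * (N * ((real (length xs) + 1) * (real (length ys) + 1)) / (real k)\<^sup>2)
      = N * (2 * (real (length xs) + 1) * (real (length ys) + 1) / (real k)\<^sup>2 + 2 * real k + 2)"
    using k by (simp add: field_simps)
  finally show ?thesis using ij by blast
qed

text \<open>All visited points lie on one line, which cannot contain neighbours of a point in two
  different coordinate directions. The multiples of \<open>a\<close> are distinct, and the start is
  the only one not counted.\<close>

lemma nbdry0_replicate:
  fixes a :: "int ^ 'd"
  assumes "CARD('d) \<ge> 2" "a \<noteq> 0"
  shows "nbdry0 (replicate n a) = n"
proof -
  obtain h where h: "a $ h \<noteq> 0" using assms(2) by (auto simp: vec_eq_iff)
  define s where "s i = sum_list (replicate i a)" for i
  have s: "s i $ l = int i * a $ l" for i l by (simp add: s_def sum_list_replicate_nth)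
  have sites: "sites (replicate n a) = s ` {..n}"
    by (auto simp: sites_def s_def min_def)
  have inj: "inj s"
    using h by (intro injI) (metis mult_cancel_right of_nat_eq_iff s)
  obtain l :: 'd where l: "l \<noteq> h"
  proof -
    have "(UNIV :: 'd set) \<noteq> {h}"
    proof
      assume "(UNIV :: 'd set) = {h}"
      then have "CARD('d) = card {h}" by (rule arg_cong)
      then show False using assms(1) by simp
    qed
    then show ?thesis using that by blast
  qed
  have "\<not> nbrs (s i) \<subseteq> s ` {..n}" for i
  proof
    assume sub: "nbrs (s i) \<subseteq> s ` {..n}"
    have in_nb: "s i + axis g 1 \<in> nbrs (s i)" for g
      using axis_in_nbrs[of g] by (simp add: nbrs_iff[of "s i + axis g 1"])
    obtain j where j: "s i + axis h 1 = s j" using sub in_nb by blast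
    obtain j' where j': "s i + axis l 1 = s j'" using sub in_nb by blast
    have "(int j - int i) * a $ l = 0"
      using arg_cong[OF j, of "\<lambda>v. v $ l"] l by (auto simp: s axis_def algebra_simps)
    moreover have "(int j - int i) * a $ h = 1"
      using arg_cong[OF j, of "\<lambda>v. v $ h"] by (simp add: s axis_def algebra_simps)
    moreover have "(int j' - int i) * a $ l = 1"
      using arg_cong[OF j', of "\<lambda>v. v $ l"] by (simp add: s axis_def algebra_simps)
    ultimately show False by (metis mult_eq_0_iff zero_neq_one)
  qed
  then have "bdry (sites (replicate n a)) = s ` {..n}" unfolding sites bdry_def by blast
  moreover have "s 0 = 0" by (simp add: s_def)
  ultimately have "bdry (sites (replicate n a)) - {0} = s ` {..n} - s ` {0}" by simp
  also have "\<dots> = s ` ({..n} - {0})"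
    using inj by (intro inj_on_image_set_diff[symmetric, of s UNIV]) auto
  finally have "bdry (sites (replicate n a)) - {0} = s ` ({..n} - {0})" .
  then show ?thesis unfolding nbdry0_def
    using inj by (simp add: card_image inj_on_subset)
qed

section \<open>Decomposition by last visits\<close>

text \<open>A boundary point is counted at the time of its last visit.\<close>

lemma card_image_last_visit:
  fixes s :: "nat \<Rightarrow> 'b"
  shows "card {a \<in> s ` {..n}. P a} = card {i \<in> {..n}. P (s i) \<and> (\<forall>l. i < l \<and> l \<le> n \<longrightarrow> s l \<noteq> s i)}"
proof -
  have "bij_betw s {i \<in> {..n}. P (s i) \<and> (\<forall>l. i < l \<and> l \<le> n \<longrightarrow> s l \<noteq> s i)} {a \<in> s ` {..n}. P a}"
    unfolding bij_betw_def
  proof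
    show "inj_on s {i \<in> {..n}. P (s i) \<and> (\<forall>l. i < l \<and> l \<le> n \<longrightarrow> s l \<noteq> s i)}"
    proof (rule inj_onI, rule ccontr)
      fix x y assume "x \<in> {i \<in> {..n}. P (s i) \<and> (\<forall>l. i < l \<and> l \<le> n \<longrightarrow> s l \<noteq> s i)}"
        "y \<in> {i \<in> {..n}. P (s i) \<and> (\<forall>l. i < l \<and> l \<le> n \<longrightarrow> s l \<noteq> s i)}" "s x = s y" "x \<noteq> y"
      then show False by (cases x y rule: linorder_cases) auto
    qed
    show "s ` {i \<in> {..n}. P (s i) \<and> (\<forall>l. i < l \<and> l \<le> n \<longrightarrow> s l \<noteq> s i)} = {a \<in> s ` {..n}. P a}"
    proof (intro equalityI subsetI)
      fix a assume a: "a \<in> {a \<in> s ` {..n}. P a}"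
      define T where "T = {i \<in> {..n}. s i = a}"
      have T: "finite T" "T \<noteq> {}" using a by (auto simp: T_def)
      have i: "s (Max T) = a" "Max T \<le> n" using Max_in[OF T] unfolding T_def by auto
      have "s l \<noteq> a" if "Max T < l" "l \<le> n" for l
      proof
        assume "s l = a"
        then have "l \<in> T" using that by (simp add: T_def)
        then have "l \<le> Max T" using T by simp
        with that show False by simp
      qed
      then show "a \<in> s ` {i \<in> {..n}. P (s i) \<and> (\<forall>l. i < l \<and> l \<le> n \<longrightarrow> s l \<noteq> s i)}"
        using a i by (intro image_eqI[of _ _ "Max T"]) simp_all
    qed auto
  qed
  then show ?thesis by (simp add: bij_betw_same_card)
qed

definition return_free :: "(int ^ 'd) list \<Rightarrow> bool" where
  "return_free xs \<longleftrightarrow> 0 \<notin> (\<lambda>i. sum_list (take i xs)) ` {1..length xs}"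

text \<open>The walk seen from its position at a given time: \<open>us\<close> are the past increments, most
  recent first, and \<open>xs\<close> the future ones.\<close>

definition last_bdry_visit :: "(int ^ 'd) list \<Rightarrow> (int ^ 'd) list \<Rightarrow> bool" where
  "last_bdry_visit us xs \<longleftrightarrow> \<not> nbrs 0 \<subseteq> sites xs \<union> uminus ` sites us \<and> return_free xs"

text \<open>Charging each boundary point to its last visit turns the number of points into a sum
  over times. From the position at that time, \<open>sites_rev\<close> presents the past as a
  negated path with reversed increments.\<close>

lemma nbdry_eq_sum:
  "real (nbdry zs) = (\<Sum>i\<le>length zs. of_bool (last_bdry_visit (rev (take i zs)) (drop i zs)))"
proof -
  define s where "s i = sum_list (take i zs)" for i
  define n where "n = length zs"
  have *: "\<not> nbrs (s i) \<subseteq> s ` {..n} \<and> (\<forall>l. i < l \<and> l \<le> n \<longrightarrow> s l \<noteq> s i)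
    \<longleftrightarrow> last_bdry_visit (rev (take i zs)) (drop i zs)" if i: "i \<le> n" for i
  proof -
    have "s ` {..n} = sites (take i zs @ drop i zs)" by (simp add: sites_def s_def n_def)
    also have "\<dots> = (+) (s i) ` (sites (drop i zs) \<union> (+) (- s i) ` sites (take i zs))"
      unfolding sites_append by (simp add: s_def image_Un image_image Un_commute)
    also have "(+) (- s i) ` sites (take i zs) = uminus ` sites (rev (take i zs))"
      unfolding s_def by (rule sites_rev)
    finally have "nbrs (s i) \<subseteq> s ` {..n} \<longleftrightarrow> nbrs 0 \<subseteq> sites (drop i zs) \<union> uminus ` sites (rev (take i zs))"
      using nbrs_translate[of "s i" 0] by (simp add: inj_image_subset_iff)
    moreover have "(\<forall>l. i < l \<and> l \<le> n \<longrightarrow> s l \<noteq> s i) \<longleftrightarrow> return_free (drop i zs)"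
    proof -
      have s_add: "s (i + l) = s i + sum_list (take l (drop i zs))" for l
        by (simp add: s_def take_add)
      have "(\<forall>l. i < l \<and> l \<le> n \<longrightarrow> s l \<noteq> s i) \<longleftrightarrow> (\<forall>l. 1 \<le> l \<and> l \<le> n - i \<longrightarrow> s (i + l) \<noteq> s i)"
      proof (intro iffI allI impI)
        fix l assume A: "\<forall>l. 1 \<le> l \<and> l \<le> n - i \<longrightarrow> s (i + l) \<noteq> s i" "i < l \<and> l \<le> n"
        have "i + (l - i) = l" using A(2) by simp
        moreover have "s (i + (l - i)) \<noteq> s i" using A by (intro A(1)[rule_format]) auto
        ultimately show "s l \<noteq> s i" by simp
      qed (use i in auto)
      also have "\<dots> \<longleftrightarrow> return_free (drop i zs)"
        by (auto simp: s_add return_free_def n_def)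
      finally show ?thesis .
    qed
    ultimately show ?thesis by (simp add: last_bdry_visit_def)
  qed
  have "nbdry zs = card {a \<in> s ` {..n}. \<not> nbrs a \<subseteq> s ` {..n}}"
    by (simp add: nbdry_def bdry_def sites_def s_def n_def)
  also have "\<dots> = card {i \<in> {..n}. \<not> nbrs (s i) \<subseteq> s ` {..n} \<and> (\<forall>l. i < l \<and> l \<le> n \<longrightarrow> s l \<noteq> s i)}"
    by (rule card_image_last_visit)
  also have "{i \<in> {..n}. \<not> nbrs (s i) \<subseteq> s ` {..n} \<and> (\<forall>l. i < l \<and> l \<le> n \<longrightarrow> s l \<noteq> s i)}
      = {i \<in> {..n}. last_bdry_visit (rev (take i zs)) (drop i zs)}"
    using * by auto
  finally show ?thesis by (simp add: sum.If_cases of_bool_def n_def Collect_conj_eq atMost_def)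
qed

section \<open>Laws of lists of increments\<close>

lemma measure_pmf_mono_support:
  assumes "\<And>x. x \<in> set_pmf A \<Longrightarrow> x \<in> S \<Longrightarrow> x \<in> T"
  shows "measure_pmf.prob A S \<le> measure_pmf.prob A T"
proof -
  have "measure_pmf.prob A (S \<inter> set_pmf A) \<le> measure_pmf.prob A T"
    using assms by (intro measure_pmf.finite_measure_mono) auto
  then show ?thesis by (simp add: measure_Int_set_pmf)
qed

text \<open>An injective map under which point masses shrink at most by the factor \<open>c\<close>
  transports events with the same loss. It is applied to the joining of two paths.\<close>

lemma measure_pmf_image_ge:
  assumes "inj_on T G" "0 \<le> c" "\<And>x. x \<in> G \<Longrightarrow> c * pmf A x \<le> pmf B (T x)"
  shows "c * measure_pmf.prob A G \<le> measure_pmf.prob B (T ` G)"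
proof -
  have "c * measure_pmf.prob A G = infsetsum (\<lambda>x. c * pmf A x) G"
    by (simp add: measure_pmf_conv_infsetsum infsetsum_cmult_right pmf_abs_summable)
  also have "\<dots> \<le> infsetsum (\<lambda>x. pmf B (T x)) G"
    using assms abs_summable_on_reindex_iff[OF assms(1), of "pmf B"]
    by (intro infsetsum_mono Infinite_Set_Sum.abs_summable_on_cmult_right) (auto simp: pmf_abs_summable)
  also have "\<dots> = measure_pmf.prob B (T ` G)"
    using assms(1) by (simp add: infsetsum_reindex measure_pmf_conv_infsetsum)
  finally show ?thesis .
qed

lemma replicate_pmf_append:
  "replicate_pmf (m + n) p = map_pmf (\<lambda>(xs, ys). xs @ ys) (pair_pmf (replicate_pmf m p) (replicate_pmf n p))"
  by (simp add: replicate_pmf_distrib pair_pmf_def map_pmf_def bind_assoc_pmf bind_return_pmf)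

lemma length_replicate_pmf: "xs \<in> set_pmf (replicate_pmf n p) \<Longrightarrow> length xs = n"
  by (simp add: set_replicate_pmf)

lemma pmf_replicate_pmf:
  "pmf (replicate_pmf n p) xs = (if length xs = n then prod_list (map (pmf p) xs) else 0)"
proof (induction n arbitrary: xs)
  case 0
  then show ?case by (auto simp: indicator_def)
next
  case (Suc n)
  have rep: "replicate_pmf (Suc n) p = map_pmf (\<lambda>(x, xs). x # xs) (pair_pmf p (replicate_pmf n p))"
    by (simp add: pair_pmf_def map_pmf_def bind_assoc_pmf bind_return_pmf)
  show ?case
  proof (cases xs)
    case Nil
    then show ?thesis
      using length_replicate_pmf[of xs "Suc n" p] by (auto simp: pmf_eq_0_set_pmf simp del: replicate_pmf.simps)
  next
    case (Cons x ys)
    have "pmf (replicate_pmf (Suc n) p) xs = pmf (pair_pmf p (replicate_pmf n p)) (x, ys)"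
      unfolding rep Cons using pmf_map_inj'[of "\<lambda>(x, xs). x # xs" "pair_pmf p (replicate_pmf n p)" "(x, ys)"]
      by (auto simp: inj_def)
    then show ?thesis using Cons Suc by (simp add: pmf_pair)
  qed
qed

lemma map_rev_replicate_pmf: "map_pmf rev (replicate_pmf n p) = replicate_pmf n p"
proof (rule pmf_eqI)
  fix xs :: "'a list"
  have "pmf (map_pmf rev (replicate_pmf n p)) (rev (rev xs)) = pmf (replicate_pmf n p) (rev xs)"
    by (rule pmf_map_inj') (auto simp: inj_def)
  then show "pmf (map_pmf rev (replicate_pmf n p)) xs = pmf (replicate_pmf n p) xs"
    by (simp add: pmf_replicate_pmf rev_map[symmetric])
qed

section \<open>Tail probabilities and exponential moments\<close>

definition tail :: "(int ^ 'd) pmf \<Rightarrow> nat \<Rightarrow> real \<Rightarrow> real" where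
  "tail p n y = measure_pmf.prob (replicate_pmf n p) {xs. y \<le> real (nbdry xs)}"

definition full_prob :: "(int ^ 'd) pmf \<Rightarrow> nat \<Rightarrow> real" where
  "full_prob p n = measure_pmf.prob (replicate_pmf n p) {xs. nbdry0 xs = n}"

text \<open>The use of \<open>nbdry0\<close>, which is exactly subadditive, makes the moments
  submultiplicative without error terms; values in \<open>ennreal\<close> avoid integrability
  conditions.\<close>

definition mgf :: "(int ^ 'd) pmf \<Rightarrow> real \<Rightarrow> nat \<Rightarrow> ennreal" where
  "mgf p \<theta> n = (\<integral>\<^sup>+xs. ennreal (exp (\<theta> * real (nbdry0 xs))) \<partial>measure_pmf (replicate_pmf n p))"

lemma tail_nonneg: "0 \<le> tail p n y" and tail_le_1: "tail p n y \<le> 1"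
  by (simp_all add: tail_def)

lemma tail_antimono: "y \<le> z \<Longrightarrow> tail p n z \<le> tail p n y"
  unfolding tail_def by (intro measure_pmf.finite_measure_mono) auto

lemma tail_eq_0: "real n + 1 < y \<Longrightarrow> tail p n y = 0"
proof -
  assume y: "real n + 1 < y"
  have "tail p n y \<le> measure_pmf.prob (replicate_pmf n p) {}"
    unfolding tail_def
  proof (rule measure_pmf_mono_support)
    fix xs assume "xs \<in> set_pmf (replicate_pmf n p)" "xs \<in> {xs. y \<le> real (nbdry xs)}"
    then show "xs \<in> {}" using nbdry_le[of xs] y by (auto dest!: length_replicate_pmf)
  qed
  then show ?thesis using tail_nonneg[of p n y] by simp
qed

lemma prob_prefix:
  assumes "\<And>xs ys. length xs = m \<Longrightarrow> length ys = n \<Longrightarrow> xs \<in> S \<Longrightarrow> xs @ ys \<in> T"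
  shows "measure_pmf.prob (replicate_pmf m p) S \<le> measure_pmf.prob (replicate_pmf (m + n) p) T"
proof -
  let ?Q = "pair_pmf (replicate_pmf m p) (replicate_pmf n p)"
  have "measure_pmf.prob (replicate_pmf m p) S = measure_pmf.prob (map_pmf fst ?Q) S"
    by (simp add: map_fst_pair_pmf)
  also have "\<dots> = measure_pmf.prob ?Q (fst -` S)" by simp
  also have "\<dots> \<le> measure_pmf.prob ?Q ((\<lambda>(xs, ys). xs @ ys) -` T)"
    using assms by (intro measure_pmf_mono_support) (auto simp: length_replicate_pmf)
  finally show ?thesis by (simp add: replicate_pmf_append)
qed

lemma tail_extend:
  fixes p :: "(int ^ 'd) pmf"
  shows "tail p n y \<le> tail p (n + r) (y - 2 * real (card (nbhd0 :: (int ^ 'd) set)) * real r)"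
  unfolding tail_def
proof (rule prob_prefix)
  fix xs ys :: "(int ^ 'd) list" assume *: "length ys = r" "xs \<in> {xs. y \<le> real (nbdry xs)}"
  have "real (nbdry xs) \<le> real (nbdry (xs @ ys) + 2 * card (nbhd0 :: (int ^ 'd) set) * length ys)"
    using nbdry_append_ge by (rule of_nat_mono)
  then show "xs @ ys \<in> {xs. y - 2 * real (card (nbhd0 :: (int ^ 'd) set)) * real r \<le> real (nbdry xs)}"
    using * by simp
qed

text \<open>Each of the last \<open>r\<close> steps contributes at most one boundary point, and 1
  more covers the starting point. This frees steps for a connection.\<close>

lemma tail_truncate: "tail p (n + r) y \<le> tail p n (y - real r - 1)"
proof -
  let ?Q = "pair_pmf (replicate_pmf n p) (replicate_pmf r p)"
  have "tail p (n + r) y = measure_pmf.prob ?Q {(xs, ys). y \<le> real (nbdry (xs @ ys))}"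
    by (simp add: tail_def replicate_pmf_append vimage_def case_prod_unfold)
  also have "\<dots> \<le> measure_pmf.prob ?Q (fst -` {xs. y - real r - 1 \<le> real (nbdry xs)})"
  proof (rule measure_pmf_mono_support, clarify)
    fix xs ys assume "(xs, ys) \<in> set_pmf ?Q" "y \<le> real (nbdry (xs @ ys))"
    moreover have "real (nbdry (xs @ ys)) \<le> real (nbdry xs + length ys + 1)"
      using nbdry_append_le by (rule of_nat_mono)
    ultimately show "(xs, ys) \<in> fst -` {xs. y - real r - 1 \<le> real (nbdry xs)}"
      by (auto dest: length_replicate_pmf)
  qed
  also have "\<dots> = measure_pmf.prob (map_pmf fst ?Q) {xs. y - real r - 1 \<le> real (nbdry xs)}" by simp
  finally show ?thesis by (simp add: tail_def map_fst_pair_pmf)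
qed

lemma full_prob_le_tail: "full_prob p n \<le> tail p n (real n)"
  unfolding full_prob_def tail_def
  by (intro measure_pmf.finite_measure_mono) (auto intro: order_trans[OF _ nbdry0_le_nbdry])

text \<open>If the joined path reaches the maximal count, subadditivity forces both parts to be
  maximal, and these are independent events.\<close>

lemma full_prob_add: "full_prob p (m + n) \<le> full_prob p m * full_prob p n"
proof -
  let ?Q = "pair_pmf (replicate_pmf m p) (replicate_pmf n p)"
  have "full_prob p (m + n) = measure_pmf.prob ?Q {(xs, ys). nbdry0 (xs @ ys) = m + n}"
    by (simp add: full_prob_def replicate_pmf_append vimage_def case_prod_unfold)
  also have "\<dots> \<le> measure_pmf.prob ?Q ({xs. nbdry0 xs = m} \<times> {ys. nbdry0 ys = n})"
  proof (rule measure_pmf_mono_support)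
    fix v assume v: "v \<in> set_pmf ?Q" "v \<in> {(xs, ys). nbdry0 (xs @ ys) = m + n}"
    obtain xs ys where [simp]: "v = (xs, ys)" by force
    have "length xs = m" "length ys = n" "nbdry0 (xs @ ys) = m + n"
      using v by (auto simp: length_replicate_pmf)
    with nbdry0_append[of xs ys] nbdry0_le[of xs] nbdry0_le[of ys]
    have "nbdry0 xs = m \<and> nbdry0 ys = n" by linarith
    then show "v \<in> {xs. nbdry0 xs = m} \<times> {ys. nbdry0 ys = n}" by simp
  qed
  also have "\<dots> = full_prob p m * full_prob p n"
    by (simp add: full_prob_def measure_pmf_prob_product)
  finally show ?thesis .
qed

lemma full_prob_mult: "full_prob p (m * k) \<le> full_prob p k ^ m"
proof (induction m)
  case 0
  then show ?case by (simp add: full_prob_def)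
next
  case (Suc m)
  have "full_prob p (k + m * k) \<le> full_prob p k * full_prob p (m * k)" by (rule full_prob_add)
  also have "\<dots> \<le> full_prob p k * full_prob p k ^ m"
    using Suc by (intro mult_left_mono) (simp_all add: full_prob_def)
  finally show ?case by simp
qed

lemma mgf_add:
  assumes "0 \<le> \<theta>"
  shows "mgf p \<theta> (m + n) \<le> mgf p \<theta> m * mgf p \<theta> n"
proof -
  let ?e = "\<lambda>xs. ennreal (exp (\<theta> * real (nbdry0 xs)))"
  have "mgf p \<theta> (m + n) = (\<integral>\<^sup>+xs. \<integral>\<^sup>+ys. ?e (xs @ ys) \<partial>measure_pmf (replicate_pmf n p) \<partial>measure_pmf (replicate_pmf m p))"
    by (simp add: mgf_def replicate_pmf_append nn_integral_pair_pmf')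
  also have "\<dots> \<le> (\<integral>\<^sup>+xs. \<integral>\<^sup>+ys. ?e xs * ?e ys \<partial>measure_pmf (replicate_pmf n p) \<partial>measure_pmf (replicate_pmf m p))"
  proof (intro nn_integral_mono)
    fix xs ys :: "(int ^ 'a) list"
    have "\<theta> * real (nbdry0 (xs @ ys)) \<le> \<theta> * real (nbdry0 xs + nbdry0 ys)"
      using assms by (intro mult_left_mono of_nat_mono nbdry0_append)
    then show "?e (xs @ ys) \<le> ?e xs * ?e ys"
      by (simp add: algebra_simps ennreal_leI flip: ennreal_mult exp_add)
  qed
  also have "\<dots> = mgf p \<theta> m * mgf p \<theta> n"
    by (simp add: mgf_def nn_integral_cmult nn_integral_multc)
  finally show ?thesis .
qed

lemma mgf_mult:
  fixes p :: "(int ^ 'd) pmf"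
  assumes "0 \<le> \<theta>"
  shows "mgf p \<theta> (j * k) \<le> mgf p \<theta> k ^ j"
proof (induction j)
  case 0
  then show ?case using nbdry0_le[of "[] :: (int ^ 'd) list"] by (simp add: mgf_def)
next
  case (Suc j)
  have "mgf p \<theta> (k + j * k) \<le> mgf p \<theta> k * mgf p \<theta> (j * k)" by (rule mgf_add[OF assms])
  also have "\<dots> \<le> mgf p \<theta> k * mgf p \<theta> k ^ j" using Suc by (rule mult_left_mono) simp
  finally show ?case by simp
qed

lemma tail_le_mgf:
  assumes "0 \<le> \<theta>" "mgf p \<theta> k \<le> ennreal B" "0 \<le> B"
  shows "tail p (j * k) (1 + y) \<le> B ^ j * exp (- \<theta> * y)"
proof -
  let ?R = "replicate_pmf (j * k) p"
  have "ennreal (exp (\<theta> * y)) * ennreal (tail p (j * k) (1 + y))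
      = (\<integral>\<^sup>+xs. ennreal (exp (\<theta> * y)) * indicator {xs. 1 + y \<le> real (nbdry xs)} xs \<partial>measure_pmf ?R)"
    by (simp add: nn_integral_cmult_indicator measure_pmf.emeasure_eq_measure tail_def)
  also have "\<dots> \<le> mgf p \<theta> (j * k)"
    unfolding mgf_def
  proof (intro nn_integral_mono)
    fix xs :: "(int ^ 'a) list"
    have "exp (\<theta> * y) \<le> exp (\<theta> * real (nbdry0 xs))" if "1 + y \<le> real (nbdry xs)"
    proof -
      have "real (nbdry xs) \<le> real (nbdry0 xs + 1)" using nbdry_le_nbdry0 by (rule of_nat_mono)
      then show ?thesis using that assms by (auto intro!: mult_left_mono)
    qed
    then show "ennreal (exp (\<theta> * y)) * indicator {xs. 1 + y \<le> real (nbdry xs)} xs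
        \<le> ennreal (exp (\<theta> * real (nbdry0 xs)))"
      by (auto simp: indicator_def ennreal_leI)
  qed
  also have "\<dots> \<le> mgf p \<theta> k ^ j" by (rule mgf_mult[OF assms(1)])
  also have "\<dots> \<le> ennreal B ^ j" using assms(2) by (intro power_mono) auto
  finally have "exp (\<theta> * y) * tail p (j * k) (1 + y) \<le> B ^ j"
    using assms(3) by (simp add: ennreal_power tail_nonneg flip: ennreal_mult)
  then show ?thesis by (simp add: exp_minus field_simps)
qed

text \<open>The parameter \<open>\<theta>\<close> balances the moment on one block: with
  \<open>f = full_prob p k\<close>, the full event contributes \<open>exp (\<theta> * k) * f\<close>
  and all other outcomes at most \<open>exp (\<theta> * (k - 1))\<close>. For
  \<open>\<theta> = - ln f\<close> the two are equal, which gives the factor 2 in the bound.\<close>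

lemma tail_le_full_prob:
  assumes k: "1 \<le> k" and f: "0 < full_prob p k" and \<epsilon>: "0 \<le> \<epsilon>"
  shows "tail p (j * k) (1 + (1 - \<epsilon>) * real (j * k)) \<le> (2 * full_prob p k powr (1 - \<epsilon> * real k)) ^ j"
proof -
  let ?f = "full_prob p k"
  define \<theta> where "\<theta> = - ln ?f"
  have f1: "?f \<le> 1" by (simp add: full_prob_def)
  have \<theta>: "0 \<le> \<theta>" using f f1 by (simp add: \<theta>_def)
  define B where "B = exp (\<theta> * real k) * ?f + exp (\<theta> * (real k - 1))"
  have B: "B = 2 * exp (\<theta> * (real k - 1))"
  proof -
    have "?f = exp (- \<theta>)" using f by (simp add: \<theta>_def)
    then have "exp (\<theta> * real k) * ?f = exp (\<theta> * (real k - 1))"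
      by (simp add: algebra_simps flip: exp_add)
    then show ?thesis by (simp add: B_def)
  qed
  have "mgf p \<theta> k \<le> (\<integral>\<^sup>+xs. ennreal (exp (\<theta> * real k)) * indicator {xs. nbdry0 xs = k} xs
      + ennreal (exp (\<theta> * (real k - 1))) \<partial>measure_pmf (replicate_pmf k p))"
    unfolding mgf_def
  proof (intro nn_integral_mono_AE AE_pmfI)
    fix xs assume "xs \<in> set_pmf (replicate_pmf k p)"
    then have "nbdry0 xs \<le> k" using nbdry0_le[of xs] by (auto dest: length_replicate_pmf)
    then consider "nbdry0 xs = k" | "real (nbdry0 xs) \<le> real k - 1" by linarith
    then show "ennreal (exp (\<theta> * real (nbdry0 xs))) \<le> ennreal (exp (\<theta> * real k)) * indicator {xs. nbdry0 xs = k} xs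
      + ennreal (exp (\<theta> * (real k - 1)))"
    proof cases
      case 1
      then show ?thesis by simp
    next
      case 2
      then have "ennreal (exp (\<theta> * real (nbdry0 xs))) \<le> ennreal (exp (\<theta> * (real k - 1)))"
        using \<theta> by (intro ennreal_leI) (auto intro!: mult_left_mono)
      then show ?thesis by (rule order_trans) (simp add: add_increasing)
    qed
  qed
  also have "\<dots> = ennreal B"
    by (simp add: nn_integral_add nn_integral_cmult_indicator measure_pmf.emeasure_eq_measure B_def
        full_prob_def flip: ennreal_mult)
  finally have "mgf p \<theta> k \<le> ennreal B" .
  moreover have "0 \<le> B" by (simp add: B)
  ultimately have "tail p (j * k) (1 + (1 - \<epsilon>) * real (j * k)) \<le> B ^ j * exp (- \<theta> * ((1 - \<epsilon>) * real (j * k)))"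
    by (intro tail_le_mgf \<theta>)
  also have "\<dots> = (B * exp (- \<theta> * ((1 - \<epsilon>) * real k))) ^ j"
    by (simp add: power_mult_distrib exp_of_nat_mult[symmetric] algebra_simps)
  also have "B * exp (- \<theta> * ((1 - \<epsilon>) * real k)) = 2 * exp (- \<theta> * (1 - \<epsilon> * real k))"
    unfolding B by (simp add: algebra_simps flip: exp_add)
  also have "exp (- \<theta> * (1 - \<epsilon> * real k)) = ?f powr (1 - \<epsilon> * real k)"
    using f by (simp add: \<theta>_def powr_def mult.commute)
  finally show ?thesis .
qed

section \<open>Expected boundary count\<close>

definition mean_bdry :: "(int ^ 'd) pmf \<Rightarrow> nat \<Rightarrow> real" where
  "mean_bdry p n = measure_pmf.expectation (replicate_pmf n p) (\<lambda>xs. real (nbdry xs))"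

definition two_sided :: "(int ^ 'd) pmf \<Rightarrow> nat \<Rightarrow> nat \<Rightarrow> real" where
  "two_sided p i j = measure_pmf.prob (pair_pmf (replicate_pmf i p) (replicate_pmf j p))
     {(us, xs). last_bdry_visit us xs}"

text \<open>Reversing a list of independent increments does not change its law, so past and future
  at time \<open>i\<close> are independent lists of \<open>i\<close> and \<open>n - i\<close>
  increments.\<close>

lemma mean_bdry_eq: "mean_bdry p n = (\<Sum>i\<le>n. two_sided p i (n - i))"
proof -
  let ?R = "replicate_pmf n p"
  have "mean_bdry p n = measure_pmf.expectation ?R (\<lambda>xs. \<Sum>i\<le>n. indicator {zs. last_bdry_visit (rev (take i zs)) (drop i zs)} xs)"
    unfolding mean_bdry_def
  proof (intro integral_cong_AE AE_pmfI)
    fix xs assume "xs \<in> set_pmf ?R"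
    then show "real (nbdry xs) = (\<Sum>i\<le>n. indicator {zs. last_bdry_visit (rev (take i zs)) (drop i zs)} xs)"
      using nbdry_eq_sum[of xs] by (simp add: length_replicate_pmf indicator_def of_bool_def)
  qed auto
  also have "\<dots> = (\<Sum>i\<le>n. measure_pmf.prob ?R {zs. last_bdry_visit (rev (take i zs)) (drop i zs)})"
    by (subst Bochner_Integration.integral_sum) (auto simp: measure_pmf.emeasure_eq_measure)
  also have "\<dots> = (\<Sum>i\<le>n. two_sided p i (n - i))"
  proof (intro sum.cong refl)
    fix i assume "i \<in> {..n}"
    then have n: "n = i + (n - i)" by simp
    let ?Q = "pair_pmf (replicate_pmf i p) (replicate_pmf (n - i) p)"
    have "measure_pmf.prob ?R {zs. last_bdry_visit (rev (take i zs)) (drop i zs)}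
        = measure_pmf.prob ?Q {(us, xs). last_bdry_visit (rev (take i (us @ xs))) (drop i (us @ xs))}"
      by (subst n, subst replicate_pmf_append) (simp add: vimage_def case_prod_unfold)
    also have "\<dots> = measure_pmf.prob ?Q {(us, xs). last_bdry_visit (rev us) xs}"
      by (intro antisym measure_pmf_mono_support) (auto dest!: length_replicate_pmf)
    also have "\<dots> = measure_pmf.prob (map_pmf (map_prod rev (\<lambda>x. x)) ?Q) {(us, xs). last_bdry_visit us xs}"
      by (simp add: vimage_def case_prod_unfold)
    also have "map_pmf (map_prod rev (\<lambda>x. x)) ?Q = ?Q"
      by (simp add: map_prod_def map_pair map_rev_replicate_pmf)
    finally show "measure_pmf.prob ?R {zs. last_bdry_visit (rev (take i zs)) (drop i zs)} = two_sided p i (n - i)"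
      by (simp add: two_sided_def)
  qed
  finally show ?thesis .
qed

lemma integrable_replicate_pmf_le_length:
  fixes g :: "(int ^ 'd) list \<Rightarrow> nat"
  assumes "\<And>xs. g xs \<le> length xs + 1"
  shows "integrable (measure_pmf (replicate_pmf n p)) (\<lambda>xs. real (g xs))"
proof (rule measure_pmf.integrable_const_bound[where B = "real n + 1"])
  show "AE xs in measure_pmf (replicate_pmf n p). norm (real (g xs)) \<le> real n + 1"
  proof (rule AE_pmfI)
    fix xs assume "xs \<in> set_pmf (replicate_pmf n p)"
    then show "norm (real (g xs)) \<le> real n + 1" using assms[of xs] by (auto dest!: length_replicate_pmf)
  qed
qed auto

text \<open>A reverse of Markov's inequality: the count is at most \<open>y\<close> off the tail
  event and at most \<open>n + 1\<close> on it. A lower bound on the mean thus gives a lower bound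
  on the tail.\<close>

lemma mean_bdry_le_tail: "mean_bdry p n \<le> y + (real n + 1) * tail p n y" if "0 \<le> y"
proof -
  let ?R = "replicate_pmf n p"
  have "mean_bdry p n \<le> measure_pmf.expectation ?R (\<lambda>xs. y + (real n + 1) * indicator {xs. y \<le> real (nbdry xs)} xs)"
    unfolding mean_bdry_def
  proof (rule integral_mono_AE)
    show "integrable (measure_pmf ?R) (\<lambda>xs. real (nbdry xs))"
      by (intro integrable_replicate_pmf_le_length nbdry_le)
    show "AE xs in measure_pmf ?R. real (nbdry xs) \<le> y + (real n + 1) * indicator {xs. y \<le> real (nbdry xs)} xs"
    proof (rule AE_pmfI)
      fix xs assume "xs \<in> set_pmf ?R"
      then show "real (nbdry xs) \<le> y + (real n + 1) * indicator {xs. y \<le> real (nbdry xs)} xs"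
        using nbdry_le[of xs] that by (auto simp: indicator_def dest!: length_replicate_pmf)
    qed
  qed (auto simp: measure_pmf.emeasure_eq_measure)
  also have "\<dots> = y + (real n + 1) * tail p n y"
    by (subst Bochner_Integration.integral_add) (auto simp: tail_def measure_pmf.emeasure_eq_measure)
  finally show ?thesis .
qed

text \<open>Uses \<open>exp t \<le> 1 + t + t\<^sup>2\<close> for \<open>0 \<le> t \<le> 1\<close>;
  hence the condition on \<open>\<theta> * k\<close>.\<close>

lemma mgf_le_mean:
  assumes \<theta>: "0 \<le> \<theta>" "\<theta> * real k \<le> 1"
  shows "mgf p \<theta> k \<le> ennreal (exp (\<theta> * mean_bdry p k + (\<theta> * real k)\<^sup>2))"
proof -
  let ?R = "replicate_pmf k p"
  have int: "integrable (measure_pmf ?R) (\<lambda>xs. real (nbdry xs))"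
    by (intro integrable_replicate_pmf_le_length nbdry_le)
  have "mgf p \<theta> k \<le> (\<integral>\<^sup>+xs. ennreal (1 + \<theta> * real (nbdry xs) + (\<theta> * real k)\<^sup>2) \<partial>measure_pmf ?R)"
    unfolding mgf_def
  proof (intro nn_integral_mono_AE AE_pmfI ennreal_leI)
    fix xs assume "xs \<in> set_pmf ?R"
    then have "real (nbdry0 xs) \<le> real k" using nbdry0_le[of xs] by (auto dest: length_replicate_pmf)
    then have le: "\<theta> * real (nbdry0 xs) \<le> \<theta> * real k" using \<theta> by (intro mult_left_mono)
    then have "exp (\<theta> * real (nbdry0 xs)) \<le> 1 + \<theta> * real (nbdry0 xs) + (\<theta> * real (nbdry0 xs))\<^sup>2"
      using \<theta> by (intro exp_bound) auto
    also have "(\<theta> * real (nbdry0 xs))\<^sup>2 \<le> (\<theta> * real k)\<^sup>2"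
      using le \<theta> by (intro power_mono) auto
    also have "\<theta> * real (nbdry0 xs) \<le> \<theta> * real (nbdry xs)"
      using \<theta> by (intro mult_left_mono of_nat_mono nbdry0_le_nbdry)
    finally show "exp (\<theta> * real (nbdry0 xs)) \<le> 1 + \<theta> * real (nbdry xs) + (\<theta> * real k)\<^sup>2" by simp
  qed
  also have "\<dots> = ennreal (measure_pmf.expectation ?R (\<lambda>xs. 1 + \<theta> * real (nbdry xs) + (\<theta> * real k)\<^sup>2))"
    using int \<theta> by (intro nn_integral_eq_integral) auto
  also have "measure_pmf.expectation ?R (\<lambda>xs. 1 + \<theta> * real (nbdry xs) + (\<theta> * real k)\<^sup>2)
      = 1 + \<theta> * mean_bdry p k + (\<theta> * real k)\<^sup>2"
    using int by (simp add: mean_bdry_def)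
  also have "1 + \<theta> * mean_bdry p k + (\<theta> * real k)\<^sup>2 \<le> exp (\<theta> * mean_bdry p k + (\<theta> * real k)\<^sup>2)"
    using exp_ge_add_one_self[of "\<theta> * mean_bdry p k + (\<theta> * real k)\<^sup>2"] by linarith
  finally show ?thesis by (simp add: ennreal_leI)
qed

section \<open>Concatenation of walks\<close>

locale lattice_walk =
  fixes p :: "(int ^ 'd) pmf" and a b :: "int ^ 'd"
  assumes dim: "CARD('d) \<ge> 2"
    and a: "a \<in> set_pmf p" and b: "b \<in> set_pmf p" and ab: "independent_steps a b"
begin

definition c :: real where "c = min (pmf p a) (pmf p b)"

definition N :: real where "N = real (card (nbhd0 :: (int ^ 'd) set))"

lemma c_pos: "0 < c" and c_le_1: "c \<le> 1" and c_le: "c \<le> pmf p a" "c \<le> pmf p b"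
  using a b by (auto simp: c_def pmf_positive_iff pmf_le_1 min_le_iff_disj)

lemma N_nonneg: "0 \<le> N"
  by (simp add: N_def)

lemma step_nonzero: "a \<noteq> 0"
  using ab by (auto simp: independent_steps_def)

lemma full_prob_ge: "c ^ n \<le> full_prob p n"
proof -
  have "c ^ n \<le> pmf p a ^ n" using c_pos c_le by (intro power_mono) auto
  also have "\<dots> = pmf (replicate_pmf n p) (replicate n a)"
    by (simp add: pmf_replicate_pmf prod_list_replicate)
  also have "\<dots> = measure_pmf.prob (replicate_pmf n p) {replicate n a}"
    by (simp add: measure_pmf_single)
  also have "\<dots> \<le> full_prob p n"
    unfolding full_prob_def using nbdry0_replicate[OF dim step_nonzero, of n]
    by (intro measure_pmf.finite_measure_mono) auto
  finally show ?thesis .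
qed

lemma pmf_connect:
  assumes "length xs = n" "length ys = m" "i < k" "j < k"
  shows "c ^ (2 * k) * (pmf (replicate_pmf n p) xs * pmf (replicate_pmf m p) ys)
    \<le> pmf (replicate_pmf (n + m + 2 * k) p) (connect a b k i j xs ys)"
proof -
  have len: "length (connect a b k i j xs ys) = n + m + 2 * k"
    using assms by (simp add: connect_def)
  have "c ^ (2 * k) = c ^ i * c ^ j * c ^ (2 * k - i - j)"
    using assms by (simp flip: power_add)
  also have "\<dots> \<le> pmf p a ^ i * pmf p b ^ j * pmf p a ^ (2 * k - i - j)"
    using c_pos c_le by (intro mult_mono power_mono) auto
  finally have "c ^ (2 * k) * (prod_list (map (pmf p) xs) * prod_list (map (pmf p) ys))
      \<le> (pmf p a ^ i * pmf p b ^ j * pmf p a ^ (2 * k - i - j)) * (prod_list (map (pmf p) xs) * prod_list (map (pmf p) ys))"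
    by (intro mult_right_mono mult_nonneg_nonneg prod_list_nonneg) auto
  also have "\<dots> = pmf (replicate_pmf (n + m + 2 * k) p) (connect a b k i j xs ys)"
    using len by (simp add: pmf_replicate_pmf) (simp add: connect_def prod_list_replicate mult_ac)
  finally show ?thesis using assms by (simp add: pmf_replicate_pmf)
qed

text \<open>The good shift depends on the two paths, so the product event is covered by the
  \<open>k\<^sup>2\<close> events that a given pair \<open>(i, j)\<close> works. On each of them the
  lengths are fixed, so joining is injective, and it costs the factor
  \<open>c ^ (2 * k)\<close>.\<close>

lemma tail_connect:
  fixes y z :: real and n m k :: nat
  assumes k: "1 \<le> k"
  defines "w \<equiv> y + z - N * (2 * (real n + 1) * (real m + 1) / (real k)\<^sup>2 + 2 * real k + 2)"
  shows "c ^ (2 * k) * (tail p n y * tail p m z) \<le> (real k)\<^sup>2 * tail p (n + m + 2 * k) w"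
proof -
  let ?Q = "pair_pmf (replicate_pmf n p) (replicate_pmf m p)"
  let ?I = "{..<k} \<times> {..<k}"
  define H where "H = (\<lambda>(i, j). {(xs, ys). length xs = n \<and> length ys = m
    \<and> w \<le> real (nbdry (connect a b k i j xs ys))})"
  have "tail p n y * tail p m z = measure_pmf.prob ?Q ({xs. y \<le> real (nbdry xs)} \<times> {ys. z \<le> real (nbdry ys)})"
    by (simp add: tail_def measure_pmf_prob_product)
  also have "\<dots> \<le> measure_pmf.prob ?Q (\<Union>(H ` ?I))"
  proof (rule measure_pmf_mono_support)
    fix v assume v: "v \<in> set_pmf ?Q" "v \<in> {xs. y \<le> real (nbdry xs)} \<times> {ys. z \<le> real (nbdry ys)}"
    obtain xs ys where [simp]: "v = (xs, ys)" by force
    have len: "length xs = n" "length ys = m" using v by (auto simp: length_replicate_pmf)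
    obtain i j where ij: "i < k" "j < k"
      "real (nbdry xs) + real (nbdry ys) \<le> real (nbdry (connect a b k i j xs ys))
        + N * (2 * (real (length xs) + 1) * (real (length ys) + 1) / (real k)\<^sup>2 + 2 * real k + 2)"
      using nbdry_connect[OF ab k, of xs ys] unfolding N_def by blast
    have "w \<le> real (nbdry (connect a b k i j xs ys))"
      using ij(3) v len by (simp add: w_def)
    then show "v \<in> \<Union>(H ` ?I)" using ij len by (auto simp: H_def)
  qed
  also have "\<dots> \<le> (\<Sum>i\<in>?I. measure_pmf.prob ?Q (H i))"
    by (intro measure_pmf.finite_measure_subadditive_finite) auto
  finally have "c ^ (2 * k) * (tail p n y * tail p m z) \<le> (\<Sum>i\<in>?I. c ^ (2 * k) * measure_pmf.prob ?Q (H i))"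
    using c_pos by (simp add: sum_distrib_left[symmetric])
  also have "\<dots> \<le> (\<Sum>i\<in>?I. tail p (n + m + 2 * k) w)"
  proof (rule sum_mono)
    fix i assume "i \<in> ?I"
    then obtain i1 i2 where i: "i = (i1, i2)" "i1 < k" "i2 < k" by auto
    let ?T = "\<lambda>(xs, ys). connect a b k i1 i2 xs ys"
    have "c ^ (2 * k) * measure_pmf.prob ?Q (H i) \<le> measure_pmf.prob (replicate_pmf (n + m + 2 * k) p) (?T ` H i)"
    proof (rule measure_pmf_image_ge)
      show "inj_on ?T (H i)"
        by (auto simp: inj_on_def H_def i connect_def)
      show "c ^ (2 * k) * pmf ?Q v \<le> pmf (replicate_pmf (n + m + 2 * k) p) (?T v)" if "v \<in> H i" for v
        using that pmf_connect[OF _ _ i(2,3)] by (auto simp: H_def i pmf_pair)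
    qed (use c_pos in auto)
    also have "\<dots> \<le> tail p (n + m + 2 * k) w"
      unfolding tail_def by (intro measure_pmf.finite_measure_mono) (auto simp: H_def i)
    finally show "c ^ (2 * k) * measure_pmf.prob ?Q (H i) \<le> tail p (n + m + 2 * k) w" .
  qed
  also have "\<dots> = (real k)\<^sup>2 * tail p (n + m + 2 * k) w"
    by (simp add: power2_eq_square)
  finally show ?thesis .
qed

text \<open>Sum of the loss \<open>5 * N + 3\<close> in level and the cost
  \<open>2 + 2 * (- ln c)\<close> in the exponent, both per unit of \<open>k\<close>; the factor 2
  in front accounts for rounding up, through \<open>k \<le> 2 * (n + m) powr (3/4)\<close>.\<close>

definition C :: real where "C = 2 * (5 * N + 5 + 2 * (- ln c))"

lemma ln_c: "0 \<le> - ln c"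
  using c_pos c_le_1 by simp

text \<open>The connection needs \<open>2 * k\<close> steps, which are taken from the end of the
  first path so that the total length remains \<open>n + m\<close>. If the first path is too short
  for this, it is given up and replaced by arbitrary steps after the second path.\<close>

lemma tail_merge:
  assumes n: "1 \<le> n" and m: "1 \<le> m"
  shows "tail p n y * tail p m z * exp (- (C * real (n + m) powr (3/4)))
    \<le> tail p (n + m) (y + z - C * real (n + m) powr (3/4))"
proof -
  define s where "s = real (n + m)"
  define k where "k = nat \<lceil>s powr (3/4)\<rceil>"
  have s: "1 \<le> s" using n by (simp add: s_def)
  have s34: "1 \<le> s powr (3/4)" using s by (simp add: ge_one_powr_ge_zero)
  have k_ge: "s powr (3/4) \<le> real k" unfolding k_def by linarith
  have k_le: "real k \<le> 2 * s powr (3/4)" unfolding k_def using s34 by linarith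
  have k1: "1 \<le> k" using s34 k_ge by linarith
  have Ck: "(5 * N + 5 + 2 * (- ln c)) * real k \<le> C * s powr (3/4)"
  proof -
    have "(5 * N + 5 + 2 * (- ln c)) * real k \<le> (5 * N + 5 + 2 * (- ln c)) * (2 * s powr (3/4))"
      using k_le N_nonneg ln_c by (intro mult_left_mono) auto
    then show ?thesis by (simp only: C_def mult_ac)
  qed
  have Nk: "0 \<le> N * real k" "0 \<le> - ln c * real k"
    by (intro mult_nonneg_nonneg N_nonneg ln_c of_nat_0_le_iff)+
  have lev: "(5 * N + 3) * real k \<le> C * s powr (3/4)"
    using Ck Nk by (simp add: algebra_simps)
  have fac: "2 * (- ln c) * real k + 2 * real k \<le> C * s powr (3/4)"
    using Ck Nk by (simp add: algebra_simps)
  show ?thesis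
  proof (cases "2 * k \<le> n")
    case True
    define n' where "n' = n - 2 * k"
    have nn: "n = n' + 2 * k" using True by (simp add: n'_def)
    \<comment> \<open>Here the size of the exponent matters:
      \<open>s\<^sup>2 \<le> s powr (9/4) \<le> k ^ 3\<close> would fail below the exponent
      2/3.\<close>
    have prod_le: "2 * (real n' + 1) * (real m + 1) / (real k)\<^sup>2 \<le> real k"
    proof -
      have "(real n' + 1) * (real m + 1) \<le> real n * (2 * real m)"
        using nn k1 m by (intro mult_mono) auto
      moreover have "4 * (real n * real m) \<le> s\<^sup>2"
      proof -
        have "0 \<le> (real n - real m)\<^sup>2" by simp
        then show ?thesis by (simp add: s_def power2_eq_square algebra_simps)
      qed
      ultimately have "2 * (real n' + 1) * (real m + 1) \<le> s\<^sup>2" by linarith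
      also have "s\<^sup>2 = s powr 2" using s by (simp add: powr_numeral)
      also have "\<dots> \<le> s powr (9/4)" using s by (intro powr_mono) auto
      also have "\<dots> = (s powr (3/4)) ^ 3" using s by (simp add: powr_powr flip: powr_numeral)
      also have "\<dots> \<le> real k ^ 3" using k_ge by (intro power_mono) auto
      finally show ?thesis using k1 by (simp add: divide_simps power2_eq_square power3_eq_cube mult_ac)
    qed
    define w where "w = (y - real (2 * k) - 1) + z
      - N * (2 * (real n' + 1) * (real m + 1) / (real k)\<^sup>2 + 2 * real k + 2)"
    have w: "y + z - C * s powr (3/4) \<le> w"
    proof -
      have "N * (2 * (real n' + 1) * (real m + 1) / (real k)\<^sup>2 + 2 * real k + 2) \<le> N * (5 * real k)"
        using prod_le k1 N_nonneg by (intro mult_left_mono) auto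
      then show ?thesis using lev k1 by (simp add: w_def algebra_simps)
    qed
    have "tail p n y * tail p m z \<le> tail p n' (y - real (2 * k) - 1) * tail p m z"
      unfolding nn by (intro mult_right_mono tail_truncate tail_nonneg)
    then have "c ^ (2 * k) * (tail p n y * tail p m z)
        \<le> c ^ (2 * k) * (tail p n' (y - real (2 * k) - 1) * tail p m z)"
      using c_pos by (intro mult_left_mono) auto
    also have "\<dots> \<le> (real k)\<^sup>2 * tail p (n' + m + 2 * k) w"
      unfolding w_def by (rule tail_connect[OF k1])
    also have "n' + m + 2 * k = n + m" using nn by simp
    also have "(real k)\<^sup>2 * tail p (n + m) w \<le> (real k)\<^sup>2 * tail p (n + m) (y + z - C * s powr (3/4))"
      using w by (intro mult_left_mono tail_antimono) auto
    finally have 1: "c ^ (2 * k) * (tail p n y * tail p m z)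
        \<le> (real k)\<^sup>2 * tail p (n + m) (y + z - C * s powr (3/4))" .
    \<comment> \<open>The part \<open>exp (- 2 * k)\<close> of the error factor pays for the number
      \<open>k\<^sup>2\<close> of shifts, the rest for \<open>c ^ (2 * k)\<close>.\<close>
    have "exp (- (C * s powr (3/4))) \<le> exp (2 * real k * ln c - 2 * real k)"
      using fac by (simp add: mult_ac)
    also have "\<dots> = exp (real (2 * k) * ln c) * exp (2 * (- real k))"
      by (simp flip: exp_add)
    also have "\<dots> = c ^ (2 * k) * exp (- real k) ^ 2"
      unfolding exp_of_nat_mult exp_double using c_pos by simp
    also have "\<dots> \<le> c ^ (2 * k) * (1 / real k)\<^sup>2"
    proof -
      have "real k \<le> exp (real k)" using exp_ge_add_one_self[of "real k"] by linarith
      then have "exp (- real k) \<le> 1 / real k" using k1 by (simp add: exp_minus field_simps)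
      then show ?thesis using c_pos by (intro mult_left_mono power_mono) auto
    qed
    finally have 2: "exp (- (C * s powr (3/4))) \<le> c ^ (2 * k) * (1 / real k)\<^sup>2" .
    have "tail p n y * tail p m z * exp (- (C * s powr (3/4)))
        \<le> tail p n y * tail p m z * (c ^ (2 * k) * (1 / real k)\<^sup>2)"
      using 2 by (intro mult_left_mono mult_nonneg_nonneg tail_nonneg)
    also have "\<dots> = (c ^ (2 * k) * (tail p n y * tail p m z)) * (1 / real k)\<^sup>2" by (simp add: mult_ac)
    also have "\<dots> \<le> ((real k)\<^sup>2 * tail p (n + m) (y + z - C * s powr (3/4))) * (1 / real k)\<^sup>2"
      using 1 by (intro mult_right_mono) auto
    also have "\<dots> = tail p (n + m) (y + z - C * s powr (3/4))" using k1 by (simp add: power_divide)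
    finally show ?thesis unfolding s_def .
  next
    case False
    have "0 \<le> (5 * N + 3) * real k" using N_nonneg by simp
    then have e1: "exp (- (C * s powr (3/4))) \<le> 1" using lev by simp
    \<comment> \<open>With fewer than \<open>2 * k\<close> steps, a reachable level
      \<open>y \<le> n + 1\<close> is itself of order \<open>k\<close> and is absorbed by the error
      term; a higher level has probability 0.\<close>
    show ?thesis
    proof (cases "y \<le> real n + 1")
      case True
      have "tail p n y * tail p m z * exp (- (C * s powr (3/4))) \<le> 1 * tail p m z * 1"
        using e1 by (intro mult_mono tail_le_1 mult_nonneg_nonneg tail_nonneg) auto
      also have "\<dots> \<le> tail p (m + n) (z - 2 * N * real n)"
        using tail_extend[of p m z n] by (simp add: N_def)
      also have "\<dots> \<le> tail p (m + n) (y + z - C * s powr (3/4))"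
      proof (rule tail_antimono)
        have nk: "real n + 1 \<le> 2 * real k" using False by linarith
        have "N * real n \<le> N * (2 * real k)"
          using nk N_nonneg by (intro mult_left_mono) auto
        then have "y + 2 * N * real n \<le> (5 * N + 3) * real k"
          using True nk Nk by (simp add: algebra_simps)
        then show "y + z - C * s powr (3/4) \<le> z - 2 * N * real n" using lev by linarith
      qed
      finally show ?thesis by (simp add: s_def add.commute)
    next
      case False
      then have "tail p n y = 0" by (intro tail_eq_0) simp
      then show ?thesis by (simp add: tail_nonneg)
    qed
  qed
qed

sublocale near_supermultiplicative_top "tail p" C "2 * N" c "full_prob p"
proof
  show "0 \<le> C" using N_nonneg ln_c by (simp add: C_def)
  show "0 \<le> 2 * N" using N_nonneg by simp
  show "0 < c" by (rule c_pos)
  show "tail p n y * tail p m z * exp (- (C * real (n + m) powr (3/4)))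
    \<le> tail p (n + m) (y + z - C * real (n + m) powr (3/4))" if "1 \<le> n" "1 \<le> m" for n m y z
    using that by (rule tail_merge)
  show "tail p n y \<le> tail p (n + r) (y - 2 * N * real r)" for n y r
    unfolding N_def by (rule tail_extend)
  show "c ^ n \<le> tail p n (real n)" for n
    using full_prob_ge full_prob_le_tail by (rule order_trans)
  show f: "0 < full_prob p k" for k
    using full_prob_ge[of k] c_pos by (meson less_le_trans zero_less_power)
  show "tail p (j * k) (1 + (1 - \<epsilon>) * real (j * k)) \<le> (2 * full_prob p k powr (1 - \<epsilon> * real k)) ^ j"
    if "1 \<le> k" "0 \<le> \<epsilon>" for k \<epsilon> j
    using that f by (intro tail_le_full_prob)
qed (rule tail_nonneg tail_le_1 tail_antimono full_prob_le_tail full_prob_mult; assumption?)+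

end

section \<open>From the process to lists of increments\<close>

lemma (in prob_space) law_eqI:
  fixes Y :: "'a \<Rightarrow> 'b :: countable"
  assumes [measurable]: "Y \<in> M \<rightarrow>\<^sub>M count_space UNIV"
    and eq: "\<And>y. prob {\<omega> \<in> space M. Y \<omega> = y} = pmf r y"
  shows "prob {\<omega> \<in> space M. Y \<omega> \<in> A} = measure_pmf.prob r A"
proof -
  have "distr M (count_space UNIV) Y = measure_pmf r"
  proof (rule measure_eqI_countable)
    fix y
    have "emeasure (distr M (count_space UNIV) Y) {y} = emeasure M {\<omega> \<in> space M. Y \<omega> = y}"
      by (subst emeasure_distr) (auto intro!: arg_cong[where f = "emeasure M"])
    then show "emeasure (distr M (count_space UNIV) Y) {y} = emeasure (measure_pmf r) {y}"
      by (simp add: emeasure_eq_measure eq emeasure_pmf_single)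
  qed auto
  then have "measure_pmf.prob r A = measure (distr M (count_space UNIV) Y) A" by simp
  also have "\<dots> = prob {\<omega> \<in> space M. Y \<omega> \<in> A}"
    by (subst measure_distr) (auto intro!: arg_cong[where f = prob])
  finally show ?thesis by simp
qed

lemma (in prob_space) exists_pmf_law:
  fixes Y :: "'a \<Rightarrow> 'b :: countable"
  assumes [measurable]: "Y \<in> M \<rightarrow>\<^sub>M count_space UNIV"
  obtains r where "\<And>y. pmf r y = prob {\<omega> \<in> space M. Y \<omega> = y}"
proof
  let ?D = "distr M (count_space UNIV) Y"
  have "(\<integral>\<^sup>+y. ennreal (prob {\<omega> \<in> space M. Y \<omega> = y}) \<partial>count_space UNIV)
      = (\<integral>\<^sup>+y. emeasure ?D {y} \<partial>count_space UNIV)"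
    by (intro nn_integral_cong, subst emeasure_distr)
      (auto simp flip: emeasure_eq_measure intro!: arg_cong[where f = "emeasure M"])
  also have "\<dots> = emeasure ?D UNIV"
    by (intro emeasure_countable_singleton[symmetric]) auto
  also have "\<dots> = 1"
    by (subst emeasure_distr) (auto simp: emeasure_space_1)
  finally show "pmf (embed_pmf (\<lambda>y. prob {\<omega> \<in> space M. Y \<omega> = y})) y = prob {\<omega> \<in> space M. Y \<omega> = y}" for y
    by (intro pmf_embed_pmf) auto
qed

section \<open>Increments and positions of the process\<close>

definition steps :: "(nat \<Rightarrow> 'a \<Rightarrow> int ^ 'd) \<Rightarrow> nat \<Rightarrow> 'a \<Rightarrow> (int ^ 'd) list" where
  "steps X n \<omega> = map (\<lambda>i. X i \<omega>) [1..<Suc n]"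

lemma length_steps [simp]: "length (steps X n \<omega>) = n"
  by (simp add: steps_def)

lemma sum_take_steps:
  assumes "i \<le> n" shows "sum_list (take i (steps X n \<omega>)) = walk X i \<omega>"
proof -
  have "take i (steps X n \<omega>) = map (\<lambda>i. X i \<omega>) [1..<Suc i]"
    unfolding steps_def take_map using assms by (subst take_upt) auto
  then show ?thesis
    by (simp only: interv_sum_list_conv_sum_set_nat set_upt atLeastLessThanSuc_atLeastAtMost walk_def)
qed

lemma boundary_count_walk: "boundary_count (walk X) n \<omega> = nbdry (steps X n \<omega>)"
proof -
  have "sites (steps X n \<omega>) = (\<lambda>m. walk X m \<omega>) ` {0..n}"
    unfolding sites_def by (intro image_cong) (auto simp: sum_take_steps)
  moreover have "inner_boundary s n = bdry (s ` {0..n})" for s :: "nat \<Rightarrow> int ^ 'b"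
    by (auto simp: inner_boundary_def bdry_def)
  ultimately show ?thesis by (simp add: boundary_count_def nbdry_def)
qed

text \<open>The dual walk is given only through the law of its positions, so the two-sided events
  have to be expressed by lists of positions rather than of increments.\<close>

definition psums :: "(int ^ 'd) list \<Rightarrow> (int ^ 'd) list" where
  "psums xs = map (\<lambda>i. sum_list (take i xs)) [0..<Suc (length xs)]"

lemma set_psums: "set (psums xs) = sites xs"
  unfolding psums_def sites_def by (auto simp del: upt_Suc)

lemma return_free_psums: "return_free xs \<longleftrightarrow> 0 \<notin> set (tl (psums xs))"
proof -
  have "tl (psums xs) = map (\<lambda>i. sum_list (take i xs)) [1..<Suc (length xs)]"
    unfolding psums_def map_tl[symmetric] by (simp only: tl_upt One_nat_def)
  then show ?thesis
    by (simp only: return_free_def set_map set_upt atLeastLessThanSuc_atLeastAtMost)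
qed

lemma psums_steps: "psums (steps X n \<omega>) = map (\<lambda>m. walk X m \<omega>) [0..<Suc n]"
  unfolding psums_def by (simp add: sum_take_steps del: upt_Suc)

locale walk_space = prob_space M for M :: "'a measure" +
  fixes X S' :: "nat \<Rightarrow> 'a \<Rightarrow> int ^ 'd" and p :: "(int ^ 'd) pmf"
  assumes iid: "iid_increments M X"
    and dual: "independent_dual_walk M (walk X) S'"
    and p: "\<And>z. pmf p z = measure M {\<omega> \<in> space M. X 1 \<omega> = z}"
begin

lemma indep_X: "indep_vars (\<lambda>_. count_space UNIV) X {1..}"
  and distr_X: "1 \<le> i \<Longrightarrow> distr M (count_space UNIV) (X i) = distr M (count_space UNIV) (X 1)"
  using iid unfolding iid_increments_def by blast+

lemma measurable_X: "1 \<le> i \<Longrightarrow> X i \<in> M \<rightarrow>\<^sub>M count_space UNIV"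
  using indep_X by (simp add: indep_vars_def)

lemma prob_X: "1 \<le> i \<Longrightarrow> prob (X i -` {z} \<inter> space M) = pmf p z"
proof -
  assume i: "1 \<le> i"
  have "prob (X j -` {z} \<inter> space M) = measure (distr M (count_space UNIV) (X j)) {z}" if "1 \<le> j" for j
    using measurable_X[OF that] by (subst measure_distr) auto
  from this[OF i] this[of 1] have "prob (X i -` {z} \<inter> space M) = prob (X 1 -` {z} \<inter> space M)"
    unfolding distr_X[OF i] by simp
  also have "X 1 -` {z} \<inter> space M = {\<omega> \<in> space M. X 1 \<omega> = z}" by auto
  finally show ?thesis by (simp add: p)
qed

lemma steps_eq_iff:
  assumes "length xs = n"
  shows "steps X n \<omega> = xs \<longleftrightarrow> (\<forall>i\<in>{1..n}. X i \<omega> = xs ! (i - 1))"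
proof
  assume R: "\<forall>i\<in>{1..n}. X i \<omega> = xs ! (i - 1)"
  show "steps X n \<omega> = xs"
  proof (rule nth_equalityI)
    fix i assume i: "i < length (steps X n \<omega>)"
    then show "steps X n \<omega> ! i = xs ! i"
      using R[rule_format, of "Suc i"] by (simp add: steps_def nth_append del: upt_Suc)
  qed (use assms in simp)
next
  assume "steps X n \<omega> = xs"
  then show "\<forall>i\<in>{1..n}. X i \<omega> = xs ! (i - 1)"
    by (auto simp: steps_def simp del: upt_Suc)
qed

lemma measurable_steps [measurable]: "steps X n \<in> M \<rightarrow>\<^sub>M count_space UNIV"
  unfolding measurable_count_space_eq2_countable
proof (intro conjI ballI)
  fix xs :: "(int ^ 'd) list"
  show "steps X n -` {xs} \<inter> space M \<in> sets M"
  proof (cases "length xs = n")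
    case True
    have set_eq: "steps X n -` {xs} \<inter> space M = {\<omega> \<in> space M. \<forall>i\<in>{1..n}. X i \<omega> = xs ! (i - 1)}"
      using steps_eq_iff[OF True] by auto
    have "{\<omega> \<in> space M. X i \<omega> = xs ! (i - 1)} \<in> sets M" if "i \<in> {1..n}" for i
    proof -
      have "X i -` {xs ! (i - 1)} \<inter> space M \<in> sets M"
        using that by (intro measurable_sets[OF measurable_X]) auto
      then show ?thesis by (simp add: vimage_def Int_def conj_commute)
    qed
    then show ?thesis unfolding set_eq by (intro sets.sets_Collect_finite_All) auto
  next
    case False
    then have empty: "steps X n -` {xs} \<inter> space M = {}" by auto
    show ?thesis unfolding empty by simp
  qed
qed auto

lemma prob_steps_eq: "prob {\<omega> \<in> space M. steps X n \<omega> = xs} = pmf (replicate_pmf n p) xs"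
proof (cases "length xs = n")
  case False
  then have empty: "{\<omega> \<in> space M. steps X n \<omega> = xs} = {}" by auto
  show ?thesis unfolding empty using False by (simp add: pmf_replicate_pmf)
next
  case True
  show ?thesis
  proof (cases "n = 0")
    case True
    then show ?thesis using \<open>length xs = n\<close> by (simp add: steps_def prob_space)
  next
    case False
    have "{\<omega> \<in> space M. steps X n \<omega> = xs} = (\<Inter>i\<in>{1..n}. X i -` {xs ! (i - 1)} \<inter> space M)"
      using steps_eq_iff[OF True] False by auto
    also have "prob \<dots> = (\<Prod>i\<in>{1..n}. prob (X i -` {xs ! (i - 1)} \<inter> space M))"
      using False by (intro indep_varsD[OF indep_X]) auto
    also have "\<dots> = (\<Prod>i\<in>{1..n}. pmf p (xs ! (i - 1)))"
      by (intro prod.cong) (auto simp: prob_X)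
    also have "\<dots> = (\<Prod>i\<in>{0..<n}. pmf p (xs ! i))"
      by (rule prod.reindex_bij_witness[of _ Suc "\<lambda>i. i - 1"]) auto
    also have "\<dots> = prod_list (map (pmf p) xs)"
      using True by (simp add: prod.list_conv_set_nth)
    finally show ?thesis using True by (simp add: pmf_replicate_pmf)
  qed
qed

lemma prob_steps: "prob {\<omega> \<in> space M. steps X n \<omega> \<in> A} = measure_pmf.prob (replicate_pmf n p) A"
  by (intro law_eqI measurable_steps prob_steps_eq)

lemma prob_boundary_count:
  "prob {\<omega> \<in> space M. y \<le> real (boundary_count (walk X) n \<omega>)} = tail p n y"
  using prob_steps[of n "{xs. y \<le> real (nbdry xs)}"] by (simp add: tail_def boundary_count_walk)

abbreviation initial :: "nat \<Rightarrow> (nat \<Rightarrow> int ^ 'd) \<Rightarrow> (int ^ 'd) list" where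
  "initial n s \<equiv> map s [0..<Suc n]"

lemma measurable_initial: "initial n \<in> path_space \<rightarrow>\<^sub>M count_space UNIV"
  unfolding measurable_count_space_eq2_countable
proof (intro conjI ballI)
  fix v :: "(int ^ 'd) list"
  show "initial n -` {v} \<inter> space path_space \<in> sets path_space"
  proof (cases "length v = Suc n")
    case True
    have "initial n s = v \<longleftrightarrow> (\<forall>i\<in>{..n}. s i = v ! i)" for s
      using True by (auto simp: list_eq_iff_nth_eq less_Suc_eq_le simp del: upt_Suc)
    then have set_eq: "initial n -` {v} \<inter> space path_space
        = {s \<in> space path_space. \<forall>i\<in>{..n}. s i = v ! i}" by auto
    have "{s \<in> space path_space. s i = v ! i} \<in> sets path_space" for i
    proof -
      have "(\<lambda>s. s i) \<in> path_space \<rightarrow>\<^sub>M (count_space UNIV :: (int ^ 'd) measure)"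
        by (rule measurable_component_singleton) simp
      then have "(\<lambda>s. s i) -` {v ! i} \<inter> space path_space \<in> sets path_space"
        by (rule measurable_sets) simp
      then show ?thesis by (simp add: vimage_def Int_def conj_commute)
    qed
    then show ?thesis unfolding set_eq by (intro sets.sets_Collect_finite_All) auto
  next
    case False
    then have empty: "initial n -` {v} \<inter> space path_space = {}" by (auto simp del: upt_Suc)
    show ?thesis unfolding empty by simp
  qed
qed auto

lemma measurable_walk: "(\<lambda>\<omega> m. walk X m \<omega>) \<in> M \<rightarrow>\<^sub>M path_space"
  and measurable_dual: "(\<lambda>\<omega> m. S' m \<omega>) \<in> M \<rightarrow>\<^sub>M path_space"
proof -
  have "indep_var path_space (\<lambda>\<omega> m. walk X m \<omega>) path_space (\<lambda>\<omega> m. S' m \<omega>)"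
    using dual unfolding independent_dual_walk_def by (rule conjunct1)
  then show "(\<lambda>\<omega> m. walk X m \<omega>) \<in> M \<rightarrow>\<^sub>M path_space" "(\<lambda>\<omega> m. S' m \<omega>) \<in> M \<rightarrow>\<^sub>M path_space"
    by (rule indep_var_rv1, rule indep_var_rv2)
qed

lemma prob_initial_walk:
  "prob {\<omega> \<in> space M. initial n (\<lambda>m. walk X m \<omega>) \<in> A} = measure_pmf.prob (map_pmf psums (replicate_pmf n p)) A"
  using prob_steps[of n "psums -` A"] by (simp add: psums_steps del: upt_Suc)

lemma prob_initial_dual:
  "prob {\<omega> \<in> space M. initial n (\<lambda>m. S' m \<omega>) \<in> A}
    = measure_pmf.prob (map_pmf (map uminus \<circ> psums) (replicate_pmf n p)) A"
proof -
  have A: "initial n -` A \<inter> space path_space \<in> sets path_space"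
    using measurable_initial by (rule measurable_sets) simp
  have neg: "(\<lambda>\<omega> m. - walk X m \<omega>) \<in> M \<rightarrow>\<^sub>M path_space"
  proof (rule measurable_PiM_single')
    fix i
    have "(\<lambda>\<omega>. (\<lambda>m. walk X m \<omega>) i) \<in> M \<rightarrow>\<^sub>M count_space UNIV"
      by (rule measurable_compose[OF measurable_walk measurable_component_singleton]) simp
    then show "(\<lambda>\<omega>. - walk X i \<omega>) \<in> M \<rightarrow>\<^sub>M count_space UNIV"
      by (rule measurable_compose) simp
  qed auto
  have "prob {\<omega> \<in> space M. initial n (\<lambda>m. S' m \<omega>) \<in> A}
      = measure (distr M path_space (\<lambda>\<omega> m. S' m \<omega>)) (initial n -` A \<inter> space path_space)"
    by (subst measure_distr[OF measurable_dual A])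
      (auto intro!: arg_cong[where f = prob] simp: space_PiM simp del: upt_Suc)
  also have "distr M path_space (\<lambda>\<omega> m. S' m \<omega>) = distr M path_space (\<lambda>\<omega> m. - walk X m \<omega>)"
    using dual by (simp add: independent_dual_walk_def)
  also have "measure (distr M path_space (\<lambda>\<omega> m. - walk X m \<omega>)) (initial n -` A \<inter> space path_space)
      = prob {\<omega> \<in> space M. map uminus (initial n (\<lambda>m. walk X m \<omega>)) \<in> A}"
    by (subst measure_distr[OF neg A])
      (auto intro!: arg_cong[where f = prob] simp: space_PiM o_def simp del: upt_Suc)
  also have "\<dots> = measure_pmf.prob (map_pmf (map uminus \<circ> psums) (replicate_pmf n p)) A"
    using prob_initial_walk[of n "map uminus -` A"] by (simp add: vimage_comp del: upt_Suc)
  finally show ?thesis .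
qed

section \<open>Two-sided events and the escape probability\<close>

definition two_sided_event :: "nat \<Rightarrow> nat \<Rightarrow> 'a set" where
  "two_sided_event i j = {\<omega> \<in> space M.
     \<not> nbrs 0 \<subseteq> (\<lambda>m. walk X m \<omega>) ` {..j} \<union> (\<lambda>m. S' m \<omega>) ` {..i} \<and> 0 \<notin> (\<lambda>m. walk X m \<omega>) ` {1..j}}"

lemma two_sided_event_alt: "two_sided_event i j = {\<omega> \<in> space M.
    (initial i (\<lambda>m. S' m \<omega>), initial j (\<lambda>m. walk X m \<omega>)) \<in>
      {(v, w). \<not> nbrs 0 \<subseteq> set w \<union> set v \<and> 0 \<notin> set (tl w)}}"
proof -
  have 1: "set (initial k s) = s ` {..k}" for k s
    unfolding set_map set_upt by (simp add: atLeast0LessThan lessThan_Suc_atMost)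
  have 2: "set (tl (initial k s)) = s ` {1..k}" for k s
    unfolding map_tl[symmetric] tl_upt set_map set_upt by (simp add: atLeastLessThanSuc_atLeastAtMost)
  show ?thesis unfolding two_sided_event_def mem_Collect_eq case_prod_conv 1 2 ..
qed

lemma measurable_pair_initial:
  "(\<lambda>\<omega>. (initial i (\<lambda>m. S' m \<omega>), initial j (\<lambda>m. walk X m \<omega>))) \<in> M \<rightarrow>\<^sub>M count_space UNIV"
proof -
  have "(\<lambda>\<omega>. (initial i (\<lambda>m. S' m \<omega>), initial j (\<lambda>m. walk X m \<omega>)))
      \<in> M \<rightarrow>\<^sub>M count_space UNIV \<Otimes>\<^sub>M count_space UNIV"
    by (intro measurable_Pair measurable_compose[OF measurable_dual measurable_initial]
        measurable_compose[OF measurable_walk measurable_initial])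
  then show ?thesis by (simp add: pair_measure_countable)
qed

lemma two_sided_event_sets [measurable]: "two_sided_event i j \<in> sets M"
proof -
  let ?Y = "\<lambda>\<omega>. (initial i (\<lambda>m. S' m \<omega>), initial j (\<lambda>m. walk X m \<omega>))"
  have "two_sided_event i j = ?Y -` {(v, w). \<not> nbrs 0 \<subseteq> set w \<union> set v \<and> 0 \<notin> set (tl w)} \<inter> space M"
    unfolding two_sided_event_alt vimage_def Int_def by (rule Collect_cong) (simp only: mem_Collect_eq conj_commute)
  also have "\<dots> \<in> sets M"
    by (rule measurable_sets[OF measurable_pair_initial]) simp
  finally show ?thesis .
qed

text \<open>Independence of the two processes makes the joint law of the initial segments a product.
  The dual segment consists of negated partial sums, the form in which the past enters
  \<open>last_bdry_visit\<close>.\<close>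

lemma prob_two_sided_event: "prob (two_sided_event i j) = two_sided p i j"
proof -
  let ?f = "map uminus \<circ> psums"
  let ?R = "pair_pmf (map_pmf ?f (replicate_pmf i p)) (map_pmf psums (replicate_pmf j p))"
  let ?A = "{(v, w). \<not> nbrs 0 \<subseteq> set w \<union> set v \<and> (0 :: int ^ 'd) \<notin> set (tl w)}"
  have "prob (two_sided_event i j) = measure_pmf.prob ?R ?A"
    unfolding two_sided_event_alt
  proof (rule law_eqI[OF measurable_pair_initial])
    fix v :: "(int ^ 'd) list \<times> (int ^ 'd) list"
    obtain v1 v2 where v: "v = (v1, v2)" by force
    have ind: "indep_var path_space (\<lambda>\<omega> m. walk X m \<omega>) path_space (\<lambda>\<omega> m. S' m \<omega>)"
      using dual by (simp add: independent_dual_walk_def)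
    have "indep_var (count_space UNIV) (initial j \<circ> (\<lambda>\<omega> m. walk X m \<omega>)) (count_space UNIV) (initial i \<circ> (\<lambda>\<omega> m. S' m \<omega>))"
      using ind measurable_initial measurable_initial by (rule indep_var_compose)
    from indep_varD[OF this, of "{v2}" "{v1}"]
    have "prob {\<omega> \<in> space M. (initial i (\<lambda>m. S' m \<omega>), initial j (\<lambda>m. walk X m \<omega>)) = v}
        = prob {\<omega> \<in> space M. initial j (\<lambda>m. walk X m \<omega>) \<in> {v2}} * prob {\<omega> \<in> space M. initial i (\<lambda>m. S' m \<omega>) \<in> {v1}}"
      by (simp add: vimage_def Int_def conj_ac v o_def del: upt_Suc)
    also have "\<dots> = pmf ?R v"
      unfolding prob_initial_walk prob_initial_dual v pmf_pair by (simp add: measure_pmf_single)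
    finally show "prob {\<omega> \<in> space M. (initial i (\<lambda>m. S' m \<omega>), initial j (\<lambda>m. walk X m \<omega>)) = v} = pmf ?R v" .
  qed
  also have "?R = map_pmf (\<lambda>(us, xs). (?f us, psums xs)) (pair_pmf (replicate_pmf i p) (replicate_pmf j p))"
    by (rule map_pair[symmetric])
  also have "measure_pmf.prob \<dots> ?A = two_sided p i j"
    by (simp add: two_sided_def vimage_def case_prod_unfold last_bdry_visit_def set_psums return_free_psums)
  finally show ?thesis .
qed

definition escape_event :: "'a set" where
  "escape_event = {\<omega> \<in> space M.
     \<not> nbrs 0 \<subseteq> range (\<lambda>m. walk X m \<omega>) \<union> range (\<lambda>m. S' m \<omega>) \<and> 0 \<notin> (\<lambda>m. walk X m \<omega>) ` {1..}}"

lemma two_sided_event_antimono: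
  assumes "i \<le> i'" "j \<le> j'" shows "two_sided_event i' j' \<subseteq> two_sided_event i j"
  unfolding two_sided_event_def
proof (rule Collect_mono)
  fix \<omega>
  have *: "s ` {..i} \<subseteq> s ` {..i'}" "s ` {..j} \<subseteq> s ` {..j'}" "s ` {1..j} \<subseteq> s ` {1..j'}" for s :: "nat \<Rightarrow> int ^ 'd"
    using assms by auto
  show "\<omega> \<in> space M \<and> \<not> nbrs 0 \<subseteq> (\<lambda>m. walk X m \<omega>) ` {..j'} \<union> (\<lambda>m. S' m \<omega>) ` {..i'} \<and> 0 \<notin> (\<lambda>m. walk X m \<omega>) ` {1..j'}
    \<longrightarrow> \<omega> \<in> space M \<and> \<not> nbrs 0 \<subseteq> (\<lambda>m. walk X m \<omega>) ` {..j} \<union> (\<lambda>m. S' m \<omega>) ` {..i} \<and> 0 \<notin> (\<lambda>m. walk X m \<omega>) ` {1..j}"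
    using *(1)[of "\<lambda>m. S' m \<omega>"] *(2,3)[of "\<lambda>m. walk X m \<omega>"] by (meson Un_mono order_trans subsetD)
qed

text \<open>A point has finitely many neighbours, so if each of them is visited eventually, all are
  visited by one finite time, for instance the sum of the individual times.\<close>

lemma escape_event_eq: "escape_event = (\<Inter>k. two_sided_event k k)"
proof (intro equalityI subsetI INT_I)
  fix \<omega> k assume "\<omega> \<in> escape_event"
  then show "\<omega> \<in> two_sided_event k k"
    unfolding escape_event_def two_sided_event_def mem_Collect_eq
    by (meson Un_mono image_mono order_trans subsetD subset_UNIV Icc_subset_Ici_iff order_refl)
next
  fix \<omega> assume \<omega>: "\<omega> \<in> (\<Inter>k. two_sided_event k k)"
  define U where "U k = (\<lambda>m. walk X m \<omega>) ` {..k} \<union> (\<lambda>m. S' m \<omega>) ` {..k}" for k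
  have U: "\<not> nbrs 0 \<subseteq> U k" "0 \<notin> (\<lambda>m. walk X m \<omega>) ` {1..k}" for k
    using \<omega> by (auto simp: two_sided_event_def U_def)
  have UN: "range (\<lambda>m. walk X m \<omega>) \<union> range (\<lambda>m. S' m \<omega>) = (\<Union>k. U k)"
    by (auto simp: U_def)
  have "\<not> nbrs 0 \<subseteq> (\<Union>k. U k)"
  proof
    assume "nbrs 0 \<subseteq> (\<Union>k. U k)"
    then obtain k where k: "\<And>z. z \<in> nbrs 0 \<Longrightarrow> z \<in> U (k z)" by (metis UN_iff subsetD)
    have "U (k z) \<subseteq> U (\<Sum>z\<in>nbrs 0. k z)" if "z \<in> nbrs 0" for z
    proof -
      have "k z \<le> (\<Sum>z\<in>nbrs 0. k z)" using that by (intro member_le_sum finite_nbrs) auto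
      then show ?thesis unfolding U_def by auto
    qed
    then have "nbrs 0 \<subseteq> U (\<Sum>z\<in>nbrs 0. k z)" using k by blast
    then show False using U by blast
  qed
  moreover have "0 \<notin> (\<lambda>m. walk X m \<omega>) ` {1..}"
  proof
    assume "0 \<in> (\<lambda>m. walk X m \<omega>) ` {1..}"
    then obtain m where "1 \<le> m" "0 = walk X m \<omega>" by auto
    then have "0 \<in> (\<lambda>m. walk X m \<omega>) ` {1..m}" by auto
    then show False using U(2) by blast
  qed
  ultimately show "\<omega> \<in> escape_event"
    using \<omega> by (auto simp: escape_event_def UN two_sided_event_def)
qed

lemma escape_event_le: "prob escape_event \<le> two_sided p i j"
proof -
  have "escape_event \<subseteq> two_sided_event (max i j) (max i j)" by (auto simp: escape_event_eq)
  also have "\<dots> \<subseteq> two_sided_event i j" by (rule two_sided_event_antimono) auto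
  finally show ?thesis
    unfolding prob_two_sided_event[symmetric] by (intro finite_measure_mono) auto
qed

lemma two_sided_antimono: "i \<le> i' \<Longrightarrow> j \<le> j' \<Longrightarrow> two_sided p i' j' \<le> two_sided p i j"
  unfolding prob_two_sided_event[symmetric] by (intro finite_measure_mono two_sided_event_antimono) auto

lemma two_sided_tendsto: "(\<lambda>k. two_sided p k k) \<longlonglongrightarrow> prob escape_event"
  unfolding prob_two_sided_event[symmetric] escape_event_eq
  by (intro finite_Lim_measure_decseq decseq_SucI two_sided_event_antimono) auto

end

section \<open>The rate function\<close>

text \<open>At most \<open>2 * K\<close> times lie within \<open>K\<close> of either end, and each
  contributes at most 1; at all others both sides have at least \<open>K\<close> steps, and
  monotonicity applies.\<close>

lemma mean_bdry_le:
  assumes anti: "\<And>i i' j j'. i \<le> i' \<Longrightarrow> j \<le> j' \<Longrightarrow> two_sided p i' j' \<le> two_sided p i j"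
  shows "mean_bdry p n \<le> 2 * real K + (real n + 1) * two_sided p K K"
proof -
  have "mean_bdry p n \<le> (\<Sum>i\<le>n. indicator {..<K} i + indicator {..<K} (n - i) + two_sided p K K)"
    unfolding mean_bdry_eq
  proof (rule sum_mono)
    fix i
    have nn: "0 \<le> two_sided p K K" "two_sided p i (n - i) \<le> 1" by (simp_all add: two_sided_def)
    show "two_sided p i (n - i) \<le> indicator {..<K} i + indicator {..<K} (n - i) + two_sided p K K"
    proof (cases "K \<le> i \<and> K \<le> n - i")
      case True
      then show ?thesis using anti[of K i K "n - i"] by simp
    next
      case False
      then show ?thesis using nn by (auto simp: indicator_def)
    qed
  qed
  also have "\<dots> = (\<Sum>i\<le>n. indicator {..<K} i) + (\<Sum>i\<le>n. indicator {..<K} (n - i)) + (real n + 1) * two_sided p K K"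
    by (simp add: sum.distrib)
  also have "(\<Sum>i\<le>n. indicator {..<K} (n - i) :: real) = (\<Sum>i\<le>n. indicator {..<K} i)"
    by (rule sum.reindex_bij_witness[of _ "\<lambda>i. n - i" "\<lambda>i. n - i"]) auto
  also have "(\<Sum>i\<le>n. indicator {..<K} i :: real) \<le> real K"
  proof -
    have "(\<Sum>i\<le>n. indicator {..<K} i :: real) = real (card ({..n} \<inter> {..<K}))"
      by (simp add: indicator_def sum.If_cases lessThan_def)
    also have "\<dots> \<le> real (card {..<K})" by (intro of_nat_mono card_mono) auto
    finally show ?thesis by simp
  qed
  finally show ?thesis by simp
qed

context lattice_walk
begin

text \<open>Submultiplicativity of the exponential moment turns one block length with mean below
  \<open>n * x\<close> into an exponential bound for all multiples of \<open>n\<close>; the rate is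
  then at least \<open>\<theta> * g / (2 * n)\<close>.\<close>

lemma ext_rate_pos:
  assumes n: "1 \<le> n" and gap: "mean_bdry p n < real n * x" and x: "x \<le> 1"
  shows "0 < ext_rate x"
proof -
  define g where "g = real n * x - mean_bdry p n"
  \<comment> \<open>The first bound makes \<open>mgf_le_mean\<close> applicable, the second keeps
    its quadratic term to at most half of the gain \<open>\<theta> * g\<close>.\<close>
  define \<theta> where "\<theta> = min (1 / real n) (g / (2 * (real n)\<^sup>2))"
  have g: "0 < g" using gap by (simp add: g_def)
  have \<theta>: "0 < \<theta>" "\<theta> * real n \<le> 1" "\<theta> * (real n)\<^sup>2 \<le> g / 2"
  proof -
    show "0 < \<theta>" using g n by (simp add: \<theta>_def)
    have "\<theta> * real n \<le> 1 / real n * real n" by (intro mult_right_mono) (auto simp: \<theta>_def)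
    then show "\<theta> * real n \<le> 1" using n by simp
    have "\<theta> * (real n)\<^sup>2 \<le> g / (2 * (real n)\<^sup>2) * (real n)\<^sup>2" by (intro mult_right_mono) (auto simp: \<theta>_def)
    then show "\<theta> * (real n)\<^sup>2 \<le> g / 2" using n by simp
  qed
  have "mgf p \<theta> n \<le> ennreal (exp (\<theta> * mean_bdry p n + (\<theta> * real n)\<^sup>2))"
    using \<theta> by (intro mgf_le_mean) auto
  then have bound: "tail p (j * n) (1 + y) \<le> exp (\<theta> * mean_bdry p n + (\<theta> * real n)\<^sup>2) ^ j * exp (- \<theta> * y)" for j y
    using \<theta> by (intro tail_le_mgf) auto
  have ineq: "\<theta> * mean_bdry p n + (\<theta> * real n)\<^sup>2 \<le> \<theta> * (real n * x) - \<theta> * g / 2"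
  proof -
    have "\<theta> * (\<theta> * (real n)\<^sup>2) \<le> \<theta> * (g / 2)" using \<theta> by (intro mult_left_mono) auto
    moreover have "\<theta> * mean_bdry p n = \<theta> * (real n * x) - \<theta> * g" by (simp add: g_def algebra_simps)
    moreover have "(\<theta> * real n)\<^sup>2 = \<theta> * (\<theta> * (real n)\<^sup>2)" by (simp add: power2_eq_square)
    ultimately show ?thesis by simp
  qed
  have lower: "\<theta> * g / (2 * real n) - \<theta> / real (j * n) \<le> - ln (tail p (j * n) (real (j * n) * x)) / real (j * n)"
    if j: "1 \<le> j" for j
  proof -
    have "tail p (j * n) (real (j * n) * x)
        \<le> exp (\<theta> * mean_bdry p n + (\<theta> * real n)\<^sup>2) ^ j * exp (- \<theta> * (real (j * n) * x - 1))"
      using bound[of j "real (j * n) * x - 1"] by simp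
    also have "\<dots> \<le> exp (\<theta> * (real n * x) - \<theta> * g / 2) ^ j * exp (- \<theta> * (real (j * n) * x - 1))"
      using ineq by (intro mult_right_mono power_mono) auto
    also have "\<dots> = exp (real j * (\<theta> * (real n * x) - \<theta> * g / 2) + - \<theta> * (real (j * n) * x - 1))"
      by (simp only: exp_of_nat_mult exp_add)
    also have "real j * (\<theta> * (real n * x) - \<theta> * g / 2) + - \<theta> * (real (j * n) * x - 1) = \<theta> - real j * (\<theta> * g / 2)"
      by (simp add: algebra_simps)
    finally have "ln (tail p (j * n) (real (j * n) * x)) \<le> \<theta> - real j * (\<theta> * g / 2)"
      using p_pos[OF x, of "j * n"] ln_le_cancel_iff[of _ "exp _"] by (metis exp_gt_zero ln_exp)
    then have "(real j * (\<theta> * g / 2) - \<theta>) / real (j * n) \<le> - ln (tail p (j * n) (real (j * n) * x)) / real (j * n)"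
      by (intro divide_right_mono) auto
    moreover have "(real j * (\<theta> * g / 2) - \<theta>) / real (j * n) = \<theta> * g / (2 * real n) - \<theta> / real (j * n)"
      using j n by (simp add: field_simps)
    ultimately show ?thesis by simp
  qed
  have "(\<lambda>j. - ln (tail p (j * n) (real (j * n) * x)) / real (j * n)) \<longlonglongrightarrow> ext_rate x"
    using LIMSEQ_subseq_LIMSEQ[OF ext_rate_limit[OF x], of "\<lambda>j. j * n"] n
    by (simp add: strict_mono_def o_def)
  moreover have "(\<lambda>j. \<theta> * g / (2 * real n) - \<theta> / real (j * n)) \<longlonglongrightarrow> \<theta> * g / (2 * real n) - 0"
  proof (intro tendsto_intros)
    have "(\<lambda>j. (\<theta> / real n) / real j) \<longlonglongrightarrow> 0" by real_asymp
    then show "(\<lambda>j. \<theta> / real (j * n)) \<longlonglongrightarrow> 0" by (simp add: mult.commute)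
  qed
  ultimately have "\<theta> * g / (2 * real n) - 0 \<le> ext_rate x"
  proof (rule tendsto_le[OF sequentially_bot])
    show "eventually (\<lambda>j. \<theta> * g / (2 * real n) - \<theta> / real (j * n)
        \<le> - ln (tail p (j * n) (real (j * n) * x)) / real (j * n)) sequentially"
      using lower by (rule eventually_sequentiallyI)
  qed
  moreover have "0 < \<theta> * g / (2 * real n)" using \<theta> g n by simp
  ultimately show ?thesis by linarith
qed

text \<open>The mean is a sum of \<open>n + 1\<close> terms of size at least \<open>q\<close>, one
  more than the level \<open>n * q\<close> uses up. This surplus forces a tail of at least
  \<open>q / (n + 1)\<close>, whose logarithm is sublinear.\<close>

lemma ext_rate_eq_0:
  assumes q: "\<And>i j. q \<le> two_sided p i j" and x: "x \<le> q" "0 < q" "q \<le> 1"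
  shows "ext_rate x = 0"
proof -
  have lim: "(\<lambda>n. - ln (tail p n (real n * x)) / real n) \<longlonglongrightarrow> ext_rate x"
    using x by (intro ext_rate_limit) simp
  have "- ln (tail p n (real n * x)) / real n \<le> (ln (real n + 1) - ln q) / real n" for n
  proof -
    have "(real n + 1) * q = (\<Sum>i\<le>n. q)" by simp
    also have "\<dots> \<le> mean_bdry p n" unfolding mean_bdry_eq by (intro sum_mono q)
    also have "\<dots> \<le> real n * q + (real n + 1) * tail p n (real n * q)"
      using x by (intro mean_bdry_le_tail) simp
    finally have "q / (real n + 1) \<le> tail p n (real n * q)" by (simp add: field_simps)
    also have "\<dots> \<le> tail p n (real n * x)" using x by (intro tail_antimono mult_left_mono) auto
    finally have "ln (q / (real n + 1)) \<le> ln (tail p n (real n * x))"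
      using x p_pos[of x n] by (subst ln_le_cancel_iff) auto
    then show ?thesis using x by (intro divide_right_mono) (auto simp: ln_div)
  qed
  moreover have "(\<lambda>n. (ln (real n + 1) - ln q) / real n) \<longlonglongrightarrow> 0" by real_asymp
  ultimately have "ext_rate x \<le> 0" using lim by (intro LIMSEQ_le[OF lim]) auto
  then show ?thesis using ext_rate_nonneg[of x] by simp
qed

lemma ext_rate_nonpos_eq_0:
  assumes "x \<le> 0" shows "ext_rate x = 0"
proof -
  have "tail p n (real n * x) = 1" for n
  proof -
    have "{xs. real n * x \<le> real (nbdry (xs :: (int ^ 'd) list))} = UNIV"
      using assms by (auto intro: order_trans[OF mult_nonneg_nonpos])
    then show ?thesis by (simp add: tail_def)
  qed
  then show ?thesis using ext_rate_limit[of x] assms by (simp add: LIMSEQ_const_iff)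
qed

lemma rate_limit_ereal:
  "(\<lambda>n. ereal (1 / real n) * neg_log (tail p n (real n * x)))
    \<longlonglongrightarrow> (if x \<le> 1 then ereal (ext_rate x) else \<infinity>)"
proof (cases "x \<le> 1")
  case True
  have "ereal (1 / real n) * neg_log (tail p n (real n * x)) = ereal (- ln (tail p n (real n * x)) / real n)" for n
    using p_pos[OF True, of n] by (simp add: neg_log_def)
  then show ?thesis using ext_rate_limit[OF True] True by simp
next
  case False
  obtain n0 :: nat where n0: "1 / (x - 1) < real n0" using reals_Archimedean2 by blast
  \<comment> \<open>From \<open>n0\<close> on the level exceeds the bound \<open>n + 1\<close> on
    the count. The length 0 is excluded because the factor \<open>1 / n\<close> is 0 there.\<close>
  have "ereal (1 / real n) * neg_log (tail p n (real n * x)) = \<infinity>" if n: "max 1 n0 \<le> n" for n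
  proof -
    have "1 / (x - 1) < real n" using n n0 by linarith
    then have "real n + 1 < real n * x" using False by (simp add: field_simps)
    then have "tail p n (real n * x) = 0" by (rule tail_eq_0)
    then show ?thesis using n by (simp add: neg_log_def)
  qed
  then have "eventually (\<lambda>n. ereal (1 / real n) * neg_log (tail p n (real n * x)) = \<infinity>) sequentially"
    by (rule eventually_sequentiallyI)
  then show ?thesis using False by (simp add: tendsto_eventually)
qed

end

text \<open>The vectors whose coordinates \<open>h\<close> and \<open>l\<close> are proportional to
  those of \<open>a\<close> form a subgroup. With \<open>a $ h \<noteq> 0\<close> it misses the unit
  vector in direction \<open>l\<close>, so it cannot contain a generating set.\<close>

lemma exists_independent_steps:
  fixes T :: "(int ^ 'd) set"
  assumes dim: "CARD('d) \<ge> 2" and gen: "group_closure T = UNIV"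
  obtains a b where "a \<in> T" "b \<in> T" "independent_steps a b"
proof -
  have "\<exists>a\<in>T. a \<noteq> 0"
  proof (rule ccontr)
    assume "\<not> (\<exists>a\<in>T. a \<noteq> 0)"
    then have T0: "z = 0" if "z \<in> T" for z using that by blast
    have "z = 0" if "z \<in> group_closure T" for z
      using that by (induction rule: group_closure.induct) (auto dest: T0)
    then have "axis undefined 1 = (0 :: int ^ 'd)" using gen by blast
    then show False by simp
  qed
  then obtain a where a: "a \<in> T" "a \<noteq> 0" by blast
  then obtain h where h: "a $ h \<noteq> 0" by (auto simp: vec_eq_iff)
  have "(UNIV :: 'd set) \<noteq> {h}"
  proof
    assume "(UNIV :: 'd set) = {h}"
    then have "CARD('d) = card {h}" by (rule arg_cong)
    then show False using dim by simp
  qed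
  then obtain l where l: "l \<noteq> h" by blast
  have "\<exists>b\<in>T. independent_steps a b"
  proof (rule ccontr)
    assume "\<not> (\<exists>b\<in>T. independent_steps a b)"
    then have base: "a $ h * z $ l = a $ l * z $ h" if "z \<in> T" for z
      using that by (auto simp: independent_steps_def)
    have "a $ h * z $ l = a $ l * z $ h" if "z \<in> group_closure T" for z
      using that by (induction rule: group_closure.induct) (auto simp: base right_diff_distrib)
    then have "a $ h * axis l 1 $ l = a $ l * axis l 1 $ h" using gen by blast
    then show False using h l by (simp add: axis_def)
  qed
  then show thesis using a that by blast
qed

theorem theorem2p3:
  fixes M :: "'a measure"
    and X S S' :: "nat \<Rightarrow> 'a \<Rightarrow> int ^ 'd"
    and q :: real
  assumes dim: "CARD('d) \<ge> 2"
    and prob: "prob_space M"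
    and iid: "iid_increments M X"
    and gen: "group_closure (point_support M (X 1)) = UNIV"
    and S: "S = walk X"
    and dual: "independent_dual_walk M S S'"
    and q: "q = measure M {\<omega> \<in> space M.
              \<not> nbrs 0 \<subseteq> range (\<lambda>m. S m \<omega>) \<union> range (\<lambda>m. S' m \<omega>) \<and>
              0 \<notin> (\<lambda>m. S m \<omega>) ` {1..}}"
  shows "\<exists>\<psi> :: real \<Rightarrow> ereal.
    (\<forall>x. (\<lambda>n. ereal (1 / real n) *
              neg_log (measure M {\<omega> \<in> space M. real (boundary_count S n \<omega>) \<ge> real n * x}))
            \<longlonglongrightarrow> \<psi> x) \<and>
    (\<forall>x. 0 \<le> \<psi> x) \<and>
    (\<forall>x\<le>q. \<psi> x = 0) \<and>
    (\<forall>x. q < x \<and> x \<le> 1 \<longrightarrow> 0 < \<psi> x \<and> \<psi> x < \<infinity>) \<and>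
    (\<forall>x>1. \<psi> x = \<infinity>) \<and>
    continuous_on {0..1} \<psi> \<and>
    convex_on {0..1} (\<lambda>x. real_of_ereal (\<psi> x)) \<and>
    strict_mono_on {q..1} \<psi>"
proof -
  interpret prob_space M by (rule prob)
  have "X 1 \<in> M \<rightarrow>\<^sub>M count_space UNIV"
    using iid unfolding iid_increments_def indep_vars_def by simp
  then obtain p where p: "\<And>z. pmf p z = prob {\<omega> \<in> space M. X 1 \<omega> = z}"
    using exists_pmf_law by blast
  interpret walk_space M X S' p
    using iid dual p unfolding S by unfold_locales
  obtain a b where ab: "a \<in> point_support M (X 1)" "b \<in> point_support M (X 1)" "independent_steps a b"
    using exists_independent_steps[OF dim gen] by blast
  have supp: "point_support M (X 1) = set_pmf p"
    by (auto simp: point_support_def set_pmf_iff p less_le)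
  interpret lattice_walk p a b
    using dim ab unfolding supp by unfold_locales
  have q_eq: "q = prob escape_event" by (simp add: q S escape_event_def)
  have q01: "0 \<le> q" "q \<le> 1" by (simp_all add: q_eq)
  define \<psi> where "\<psi> x = (if x \<le> 1 then ereal (ext_rate x) else \<infinity>)" for x
  have zero: "ext_rate x = 0" if "x \<le> q" for x
  \<comment> \<open>For \<open>q = 0\<close> the bound through \<open>ln q\<close> gives nothing,
    but then only levels \<open>x \<le> 0\<close> remain, where the tail is 1.\<close>
  proof (cases "q = 0")
    case True
    then show ?thesis using that by (intro ext_rate_nonpos_eq_0) simp
  next
    case False
    then have "0 < q" using q01 by simp
    then show ?thesis using that q01 escape_event_le
      by (intro ext_rate_eq_0[of q]) (auto simp flip: q_eq)
  qed
  have pos: "0 < ext_rate x" if x: "q < x" "x \<le> 1" for x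
  proof -
    \<comment> \<open>As \<open>q\<close> is the limit of the two-sided probabilities, some finite
      horizon \<open>K\<close> already has probability below \<open>x\<close>; by
      \<open>mean_bdry_le\<close> the mean over a long enough time \<open>n\<close> is then below
      \<open>n * x\<close>.\<close>
    have "eventually (\<lambda>k. two_sided p k k < x) sequentially"
      using two_sided_tendsto x(1) unfolding q_eq by (rule order_tendstoD)
    then obtain K where K: "two_sided p K K < x" unfolding eventually_at_top_linorder by blast
    obtain n0 :: nat where n0: "(2 * real K + two_sided p K K) / (x - two_sided p K K) < real n0"
      using reals_Archimedean2 by blast
    have "(2 * real K + two_sided p K K) / (x - two_sided p K K) < real (Suc n0)"
      using n0 by simp
    then have "2 * real K + (real (Suc n0) + 1) * two_sided p K K < real (Suc n0) * x"
      using K by (simp add: pos_divide_less_eq algebra_simps)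
    then have "mean_bdry p (Suc n0) < real (Suc n0) * x"
      using mean_bdry_le[OF two_sided_antimono, of "Suc n0" K] by linarith
    then show ?thesis using x by (intro ext_rate_pos[of "Suc n0"]) auto
  qed
  have conv: "convex_on {0..1} ext_rate"
    using convex_on_ext_rate by (rule convex_on_subset) auto
  show ?thesis
  proof (intro exI[of _ \<psi>] conjI allI impI)
    fix x
    show "(\<lambda>n. ereal (1 / real n) *
              neg_log (measure M {\<omega> \<in> space M. real (boundary_count S n \<omega>) \<ge> real n * x}))
            \<longlonglongrightarrow> \<psi> x"
      unfolding S prob_boundary_count \<psi>_def by (rule rate_limit_ereal)
    show "0 \<le> \<psi> x" by (simp add: \<psi>_def ext_rate_nonneg)
  next
    fix x assume "x \<le> q"
    then show "\<psi> x = 0" using zero q01 by (simp add: \<psi>_def)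
  next
    fix x assume "q < x \<and> x \<le> 1"
    then show "0 < \<psi> x" "\<psi> x < \<infinity>" using pos by (simp_all add: \<psi>_def)
  next
    fix x :: real assume "1 < x"
    then show "\<psi> x = \<infinity>" by (simp add: \<psi>_def)
  next
    have "continuous_on {0..1} (\<lambda>x. ereal (ext_rate x))"
      by (intro continuous_on_ereal continuous_on_subset[OF continuous_on_ext_rate]) auto
    then show "continuous_on {0..1} \<psi>"
      by (rule continuous_on_cong[THEN iffD1, rotated 2]) (auto simp: \<psi>_def)
    show "convex_on {0..1} (\<lambda>x. real_of_ereal (\<psi> x))"
    proof (rule convex_onI)
      fix t x y :: real assume A: "0 < t" "t < 1" "x \<in> {0..1}" "y \<in> {0..1}"
      then have "(1 - t) *\<^sub>R x + t *\<^sub>R y \<in> {0..1}"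
        by (intro convexD_alt convex_real_interval) auto
      moreover have "ext_rate ((1 - t) *\<^sub>R x + t *\<^sub>R y) \<le> (1 - t) * ext_rate x + t * ext_rate y"
        using A by (intro convex_onD[OF conv]) auto
      ultimately show "real_of_ereal (\<psi> ((1 - t) *\<^sub>R x + t *\<^sub>R y))
          \<le> (1 - t) * real_of_ereal (\<psi> x) + t * real_of_ereal (\<psi> y)"
        using A by (simp add: \<psi>_def)
    qed (rule convex_real_interval)
  next
    show "strict_mono_on {q..1} \<psi>"
    proof (rule strict_mono_onI)
      fix x y assume xy: "x \<in> {q..1}" "y \<in> {q..1}" "x < y"
      \<comment> \<open>The rate vanishes at \<open>q\<close> and is positive at \<open>y\<close>,
        and \<open>x\<close> lies between them with a weight \<open>t < 1\<close> at
        \<open>y\<close>, so convexity gives a strict inequality.\<close>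
      define t where "t = (x - q) / (y - q)"
      have t: "0 \<le> t" "t < 1" using xy by (auto simp: t_def divide_simps)
      have "t * (y - q) = x - q" using xy by (simp add: t_def)
      then have x: "x = (1 - t) *\<^sub>R q + t *\<^sub>R y" by (simp add: algebra_simps)
      have "ext_rate x \<le> (1 - t) * ext_rate q + t * ext_rate y"
        unfolding x using xy t q01 by (intro convex_onD[OF conv]) auto
      also have "\<dots> < ext_rate y" using zero[of q] pos[of y] xy t by simp
      finally show "\<psi> x < \<psi> y" using xy by (simp add: \<psi>_def)
    qed
  qed
qed

end
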